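(* For every $N\ge1$ let $X^{(N)}$ be an $N\times N$ GUE matrix with randomly permuted rows, i.e. $X^{(N)}=U^{(N)}\cdot\frac{(G^{(N)})^*+G^{(N)}}{\sqrt2}$ with $U^{(N)},G^{(N)}$ as in the context. Then $X^{(N)}$ converges in $*$-distribution, as $N\to\infty$, to a standard circular random variable. That is, if $X$ is a standard circular element of a tracial non-commutative $*$-probability space $(\mathcal A,\varphi)$, then for every $n\ge1$ and all $\varepsilon_1,\dots,\varepsilon_n\in\{1,*\}$, $$\lim_{N\to\infty}\mathbb E\left(\mathrm{tr}^{(N)}\left[(X^{(N)})^{\varepsilon_1}\cdots(X^{(N)})^{\varepsilon_n}\right]\right)=\varphi\left(X^{\varepsilon_1}\cdots X^{\varepsilon_n}\right).$$
   Context: For each $N\ge1$: $G^{(N)}=\frac1{\sqrt N}[f_{i,j}]_{1\le i,j\le N}$, where the $f_{i,j}$ are independent complex standard Gaussian random variables (real and imaginary parts independent real Gaussians of mean $0$ and variance $1/2$); $U^{(N)}$ is a random permutation matrix uniformly distributed on the $N!$ permutation matrices of size $N$; and $U^{(N)}$ and $G^{(N)}$ are independent. The matrix $\frac{G^{(N)}+(G^{(N)})^*}{\sqrt2}$ is called a GUE matrix. $\mathrm{tr}^{(N)}A=\frac1N\sum_{i=1}^NA_{ii}$ and $\mathbb E$ is expectation. A tracial non-commutative $*$-probability space is a unital $*$-algebra $\mathcal A$ with a unital, tracial, positive linear functional $\varphi$. The non-crossing (free) cumulants $k_n:\mathcal A^n\to\mathbb C$ are the multilinear functionals determined by $\varphi(A_1\cdots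 A_n)=\sum_{\pi\in NC(n)}\prod_{V\in\pi}k_{|V|}(A_i: i\in V)$, summing over non-crossing partitions, with arguments in increasing order of index. An element $X\in\mathcal A$ is standard circular if the only non-zero cumulants with arguments in $\{X,X^*\}$ are $k_2(X,X^* )=k_2(X^*,X)=1$. *)

theory Defs
  imports
    "HOL-Probability.Probability"
    "HOL-Library.Disjoint_Sets"
    "Jordan_Normal_Form.Schur_Decomposition"
begin

section \<open>Tracial non-commutative *-probability spaces\<close>

text \<open>The underlying unital ring is a type of class \<^class>\<open>ring_1\<close>; the complex scalar
  multiplication, the involution and the functional are explicit.\<close>

locale tracial_star_prob_space = vector_space cscale
  for cscale :: "complex \<Rightarrow> 'b::ring_1 \<Rightarrow> 'b" +
  fixes star :: "'b \<Rightarrow> 'b" and \<phi> :: "'b \<Rightarrow> complex"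
  assumes scale_mult_left: "cscale c x * y = cscale c (x * y)"
    and scale_mult_right: "x * cscale c y = cscale c (x * y)"
    and star_add: "star (x + y) = star x + star y"
    and star_scale: "star (cscale c x) = cscale (cnj c) (star x)"
    and star_mult: "star (x * y) = star y * star x"
    and star_star: "star (star x) = x"
    and functional_add: "\<phi> (x + y) = \<phi> x + \<phi> y"
    and functional_scale: "\<phi> (cscale c x) = c * \<phi> x"
    and functional_one: "\<phi> 1 = 1"
    and functional_trace: "\<phi> (x * y) = \<phi> (y * x)"
    and functional_pos: "\<phi> (star x * x) \<in> \<real> \<and> 0 \<le> Re (\<phi> (star x * x))"

section \<open>Free cumulants\<close>

definition noncrossing :: "nat set set \<Rightarrow> bool" where
  "noncrossing P \<longleftrightarrow>
     \<not> (\<exists>V\<in>P. \<exists>W\<in>P. V \<noteq> W \<and>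
         (\<exists>a b c d. a < b \<and> b < c \<and> c < d \<and> a \<in> V \<and> c \<in> V \<and> b \<in> W \<and> d \<in> W))"

definition NC :: "nat \<Rightarrow> nat set set set" where
  "NC n = {P. partition_on {..<n} P \<and> noncrossing P}"

text \<open>All the cumulants \<open>k\<^sub>n\<close>, \<open>n \<ge> 1\<close>, are bundled into one function on lists, the value on a list
  of length \<open>n\<close> being \<open>k\<^sub>n\<close>. The list \<^term>\<open>nths xs V\<close> consists of the entries of \<^term>\<open>xs\<close> with index
  in \<^term>\<open>V\<close>, in increasing order of the index.\<close>

definition free_cumulant_family ::
    "(complex \<Rightarrow> 'b::ring_1 \<Rightarrow> 'b) \<Rightarrow> ('b \<Rightarrow> complex) \<Rightarrow> ('b list \<Rightarrow> complex) \<Rightarrow> bool" where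
  "free_cumulant_family cscale \<phi> k \<longleftrightarrow>
     (\<forall>xs x y ys. k (xs @ (x + y) # ys) = k (xs @ x # ys) + k (xs @ y # ys)) \<and>
     (\<forall>xs c x ys. k (xs @ cscale c x # ys) = c * k (xs @ x # ys)) \<and>
     (\<forall>xs. xs \<noteq> [] \<longrightarrow> \<phi> (prod_list xs) = (\<Sum>P\<in>NC (length xs). \<Prod>V\<in>P. k (nths xs V)))"

lemma finite_NC: "finite (NC n)"
proof (rule finite_subset)
  show "NC n \<subseteq> Pow (Pow {..<n})"
    unfolding NC_def partition_on_def by blast
qed simp

lemma NC_block_subset: "P \<in> NC n \<Longrightarrow> V \<in> P \<Longrightarrow> V \<subseteq> {..<n}"
  unfolding NC_def partition_on_def by blast

lemma NC_finite_elem: "P \<in> NC n \<Longrightarrow> finite P"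
  unfolding NC_def by (auto intro: finite_elements)

lemma NC_single: "n > 0 \<Longrightarrow> {{..<n}} \<in> NC n"
  unfolding NC_def noncrossing_def partition_on_def by (auto simp: disjoint_def)

lemma NC_block_proper:
  assumes "P \<in> NC n - {{{..<n}}}" and "V \<in> P"
  shows "V \<subset> {..<n}"
proof -
  have po: "\<Union>P = {..<n}" "disjoint P" "{} \<notin> P" and ne: "P \<noteq> {{..<n}}"
    using assms(1) by (auto simp: NC_def partition_on_def)
  have sub: "V \<subseteq> {..<n}" using assms NC_block_subset by blast
  moreover have "V \<noteq> {..<n}"
  proof
    assume eq: "V = {..<n}"
    have "W = V" if "W \<in> P" for W
    proof (rule ccontr)
      assume "W \<noteq> V"
      then have "W \<inter> V = {}" using po(2) that assms(2) unfolding disjoint_def by blast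
      moreover have "W \<subseteq> V" using po(1) that eq by blast
      ultimately show False using po(3) that by (metis inf.absorb1)
    qed
    then have "P = {{..<n}}" using assms(2) eq by blast
    then show False using ne by simp
  qed
  ultimately show ?thesis by blast
qed

lemma length_nths_proper:
  assumes "V \<subset> {..<length xs}"
  shows "length (nths xs V) < length xs"
proof -
  have "{i. i < length xs \<and> i \<in> V} \<subset> {..<length xs}" using assms by blast
  then show ?thesis
    unfolding length_nths by (metis card_lessThan finite_lessThan psubset_card_mono)
qed

text \<open>The moment-cumulant formula solved for its top term, the partition with the single block
  \<^term>\<open>{..<n}\<close>. By \<open>free_cumulant_family_iff\<close> below, this is the only family of multilinear
  functionals satisfying that formula.\<close>

function free_cumulant :: "('b::ring_1 \<Rightarrow> complex) \<Rightarrow> 'b list \<Rightarrow> complex" where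
  "free_cumulant \<phi> xs =
     \<phi> (prod_list xs) -
     (\<Sum>P\<in>NC (length xs) - {{{..<length xs}}}. \<Prod>V\<in>P. free_cumulant \<phi> (nths xs V))"
  by auto
termination
  by (relation "Wellfounded.measure (\<lambda>(\<phi>, xs). length xs)")
    (auto intro!: length_nths_proper NC_block_proper)

declare free_cumulant.simps [simp del]

lemma free_cumulant_moment:
  assumes "xs \<noteq> []"
  shows "\<phi> (prod_list xs) = (\<Sum>P\<in>NC (length xs). \<Prod>V\<in>P. free_cumulant \<phi> (nths xs V))"
proof -
  have "nths xs {..<length xs} = xs" by (rule nths_all) simp
  then show ?thesis
    using sum.remove[OF finite_NC NC_single[of "length xs"],
        of "\<lambda>P. \<Prod>V\<in>P. free_cumulant \<phi> (nths xs V)"] assms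
    by (simp add: free_cumulant.simps[of \<phi> xs])
qed

lemma moment_cumulant_unique:
  assumes "\<And>xs. xs \<noteq> [] \<Longrightarrow> \<phi> (prod_list xs) = (\<Sum>P\<in>NC (length xs). \<Prod>V\<in>P. k (nths xs V))"
    and "xs \<noteq> []"
  shows "k xs = free_cumulant \<phi> xs"
  using assms(2)
proof (induction xs rule: length_induct)
  case (1 xs)
  let ?n = "length xs"
  have all: "nths xs {..<?n} = xs" by (rule nths_all) simp
  have "\<phi> (prod_list xs) = k xs + (\<Sum>P\<in>NC ?n - {{{..<?n}}}. \<Prod>V\<in>P. k (nths xs V))"
    using sum.remove[OF finite_NC NC_single[of ?n], of "\<lambda>P. \<Prod>V\<in>P. k (nths xs V)"]
      assms(1)[OF 1(2)] 1(2) all by simp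
  moreover have "k (nths xs V) = free_cumulant \<phi> (nths xs V)"
    if "P \<in> NC ?n - {{{..<?n}}}" "V \<in> P" for P V
  proof -
    have "V \<subseteq> {..<?n}" "V \<noteq> {}"
      using NC_block_proper[OF that] that by (auto simp: NC_def partition_on_def)
    then have "{i. i < ?n \<and> i \<in> V} \<noteq> {}" by blast
    then have "length (nths xs V) \<noteq> 0"
      unfolding length_nths by (subst card_0_eq) auto
    then have "nths xs V \<noteq> []" by auto
    then show ?thesis using 1 length_nths_proper[OF NC_block_proper[OF that]] by blast
  qed
  then have "(\<Sum>P\<in>NC ?n - {{{..<?n}}}. \<Prod>V\<in>P. k (nths xs V)) =
      (\<Sum>P\<in>NC ?n - {{{..<?n}}}. \<Prod>V\<in>P. free_cumulant \<phi> (nths xs V))"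
    by (intro sum.cong prod.cong) auto
  ultimately show ?case by (simp add: free_cumulant.simps[of \<phi> xs])
qed

lemma NC_block_of:
  assumes "P \<in> NC n" "i < n"
  obtains V where "V \<in> P" "i \<in> V" "\<And>W. W \<in> P - {V} \<Longrightarrow> i \<notin> W"
proof -
  have P: "\<Union>P = {..<n}" "disjoint P" using assms by (auto simp: NC_def partition_on_def)
  have "i \<in> \<Union>P" using P(1) assms(2) by simp
  then obtain V where V: "V \<in> P" "i \<in> V" by (rule UnionE)
  have "i \<notin> W" if "W \<in> P - {V}" for W
    using disjointD[OF P(2), of W V] that V by auto
  then show thesis using V that by blast
qed

context tracial_star_prob_space
begin

lemma prod_list_slot_add:
  "\<phi> (prod_list (xs @ (x + y) # ys)) = \<phi> (prod_list (xs @ x # ys)) + \<phi> (prod_list (xs @ y # ys))"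
  by (simp add: distrib_left distrib_right functional_add)

lemma prod_list_slot_scale:
  "\<phi> (prod_list (xs @ cscale c x # ys)) = c * \<phi> (prod_list (xs @ x # ys))"
  by (simp add: scale_mult_left scale_mult_right functional_scale)

lemma nths_slot:
  "nths (xs @ x # ys) V =
     nths xs V @ (if length xs \<in> V then [x] else []) @ nths ys {j. Suc (j + length xs) \<in> V}"
  by (simp add: nths_append nths_Cons)

lemma free_cumulant_add:
  "free_cumulant \<phi> (xs @ (x + y) # ys) =
     free_cumulant \<phi> (xs @ x # ys) + free_cumulant \<phi> (xs @ y # ys)"
proof (induction "length xs + length ys" arbitrary: xs ys rule: less_induct)
  case less
  let ?n = "Suc (length xs + length ys)"
  let ?K = "\<lambda>z V. free_cumulant \<phi> (nths (xs @ z # ys) V)"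
  have "(\<Prod>V\<in>P. ?K (x + y) V) = (\<Prod>V\<in>P. ?K x V) + (\<Prod>V\<in>P. ?K y V)"
    if P: "P \<in> NC ?n - {{{..<?n}}}" for P
  proof -
    have P': "P \<in> NC ?n" using P by blast
    obtain V where V: "V \<in> P" "length xs \<in> V" "\<And>W. W \<in> P - {V} \<Longrightarrow> length xs \<notin> W"
      using NC_block_of[OF P', of "length xs"] by auto
    have split: "(\<Prod>V\<in>P. ?K z V) = ?K z V * (\<Prod>W\<in>P - {V}. ?K x W)" for z
    proof -
      have "(\<Prod>V\<in>P. ?K z V) = ?K z V * (\<Prod>W\<in>P - {V}. ?K z W)"
        using NC_finite_elem[OF P'] V(1) by (rule prod.remove)
      also have "(\<Prod>W\<in>P - {V}. ?K z W) = (\<Prod>W\<in>P - {V}. ?K x W)"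
        by (rule prod.cong) (use V(3) in \<open>auto simp: nths_slot\<close>)
      finally show ?thesis .
    qed
    have "length (nths (xs @ x # ys) V) < ?n"
      using length_nths_proper[of V "xs @ x # ys"] NC_block_proper[OF P V(1)] by simp
    then have "length (nths xs V) + length (nths ys {j. Suc (j + length xs) \<in> V})
        < length xs + length ys"
      using V(2) by (simp add: nths_slot)
    from less[OF this] have "?K (x + y) V = ?K x V + ?K y V"
      using V(2) by (simp add: nths_slot)
    then show ?thesis by (simp only: split distrib_right)
  qed
  then have "(\<Sum>P\<in>NC ?n - {{{..<?n}}}. \<Prod>V\<in>P. ?K (x + y) V) =
      (\<Sum>P\<in>NC ?n - {{{..<?n}}}. \<Prod>V\<in>P. ?K x V) + (\<Sum>P\<in>NC ?n - {{{..<?n}}}. \<Prod>V\<in>P. ?K y V)"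
    by (simp only: sum.distrib[symmetric] cong: sum.cong)
  then show ?case
    by (simp only: free_cumulant.simps[of \<phi> "xs @ _ # ys"] prod_list_slot_add
        length_append list.size(4) add_Suc_right One_nat_def add_0_right) simp
qed

lemma free_cumulant_scale:
  "free_cumulant \<phi> (xs @ cscale c x # ys) = c * free_cumulant \<phi> (xs @ x # ys)"
proof (induction "length xs + length ys" arbitrary: xs ys rule: less_induct)
  case less
  let ?n = "Suc (length xs + length ys)"
  let ?K = "\<lambda>z V. free_cumulant \<phi> (nths (xs @ z # ys) V)"
  have "(\<Prod>V\<in>P. ?K (cscale c x) V) = c * (\<Prod>V\<in>P. ?K x V)"
    if P: "P \<in> NC ?n - {{{..<?n}}}" for P
  proof -
    have P': "P \<in> NC ?n" using P by blast
    obtain V where V: "V \<in> P" "length xs \<in> V" "\<And>W. W \<in> P - {V} \<Longrightarrow> length xs \<notin> W"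
      using NC_block_of[OF P', of "length xs"] by auto
    have split: "(\<Prod>V\<in>P. ?K z V) = ?K z V * (\<Prod>W\<in>P - {V}. ?K x W)" for z
    proof -
      have "(\<Prod>V\<in>P. ?K z V) = ?K z V * (\<Prod>W\<in>P - {V}. ?K z W)"
        using NC_finite_elem[OF P'] V(1) by (rule prod.remove)
      also have "(\<Prod>W\<in>P - {V}. ?K z W) = (\<Prod>W\<in>P - {V}. ?K x W)"
        by (rule prod.cong) (use V(3) in \<open>auto simp: nths_slot\<close>)
      finally show ?thesis .
    qed
    have "length (nths (xs @ x # ys) V) < ?n"
      using length_nths_proper[of V "xs @ x # ys"] NC_block_proper[OF P V(1)] by simp
    then have "length (nths xs V) + length (nths ys {j. Suc (j + length xs) \<in> V})
        < length xs + length ys"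
      using V(2) by (simp add: nths_slot)
    from less[OF this] have "?K (cscale c x) V = c * ?K x V"
      using V(2) by (simp add: nths_slot)
    then show ?thesis by (simp only: split mult.assoc)
  qed
  then have "(\<Sum>P\<in>NC ?n - {{{..<?n}}}. \<Prod>V\<in>P. ?K (cscale c x) V) =
      c * (\<Sum>P\<in>NC ?n - {{{..<?n}}}. \<Prod>V\<in>P. ?K x V)"
    by (simp only: sum_distrib_left cong: sum.cong)
  then show ?case
    by (simp only: free_cumulant.simps[of \<phi> "xs @ _ # ys"] prod_list_slot_scale
        length_append list.size(4) add_Suc_right One_nat_def add_0_right)
      (simp add: right_diff_distrib)
qed

theorem free_cumulant_family_free_cumulant: "free_cumulant_family cscale \<phi> (free_cumulant \<phi>)"
  unfolding free_cumulant_family_def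
  using free_cumulant_add free_cumulant_scale free_cumulant_moment by blast

theorem free_cumulant_family_iff:
  "free_cumulant_family cscale \<phi> k \<longleftrightarrow> (\<forall>xs. xs \<noteq> [] \<longrightarrow> k xs = free_cumulant \<phi> xs)"
proof
  assume "free_cumulant_family cscale \<phi> k"
  then show "\<forall>xs. xs \<noteq> [] \<longrightarrow> k xs = free_cumulant \<phi> xs"
    unfolding free_cumulant_family_def using moment_cumulant_unique[of \<phi> k] by blast
next
  assume eq: "\<forall>xs. xs \<noteq> [] \<longrightarrow> k xs = free_cumulant \<phi> xs"
  have "k (nths xs V) = free_cumulant \<phi> (nths xs V)"
    if "P \<in> NC (length xs)" "V \<in> P" for xs :: "'b list" and P V
  proof -
    have "V \<subseteq> {..<length xs}" "V \<noteq> {}"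
      using that by (auto simp: NC_def partition_on_def)
    then have "{i. i < length xs \<and> i \<in> V} \<noteq> {}" by blast
    then have "length (nths xs V) \<noteq> 0"
      unfolding length_nths by (subst card_0_eq) auto
    then show ?thesis using eq by auto
  qed
  then have "(\<Sum>P\<in>NC (length xs). \<Prod>V\<in>P. k (nths xs V)) =
      (\<Sum>P\<in>NC (length xs). \<Prod>V\<in>P. free_cumulant \<phi> (nths xs V))" for xs :: "'b list"
    by (intro sum.cong prod.cong) auto
  then show "free_cumulant_family cscale \<phi> k"
    using free_cumulant_family_free_cumulant eq unfolding free_cumulant_family_def by simp
qed

end

section \<open>Standard circular elements\<close>

datatype star_exponent = Plain | Star

fun star_pow :: "('b \<Rightarrow> 'b) \<Rightarrow> 'b \<Rightarrow> star_exponent \<Rightarrow> 'b" where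
  "star_pow star x Plain = x"
| "star_pow star x Star = star x"

text \<open>The arguments of the cumulants are indexed by words in the exponents, not by lists over the
  set \<open>{X, X\<^sup>*}\<close>: for self-adjoint \<open>X\<close> the latter could not tell \<open>k\<^sub>2(X, X)\<close> from
  \<open>k\<^sub>2(X, X\<^sup>*)\<close> and would admit a semicircular \<open>X\<close>.\<close>

definition standard_circular ::
    "('b::ring_1 \<Rightarrow> 'b) \<Rightarrow> ('b \<Rightarrow> complex) \<Rightarrow> 'b \<Rightarrow> bool" where
  "standard_circular star \<phi> X \<longleftrightarrow>
     (\<forall>es. es \<noteq> [] \<longrightarrow>
       free_cumulant \<phi> (map (star_pow star X) es) =
         (if es = [Plain, Star] \<or> es = [Star, Plain] then 1 else 0))"

section \<open>Random matrices\<close>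

definition normalized_trace :: "complex mat \<Rightarrow> complex" where
  "normalized_trace A = (\<Sum>i<dim_row A. A $$ (i, i)) / of_nat (dim_row A)"

text \<open>The product of the matrices in a list, all of size \<open>N \<times> N\<close>.\<close>

definition mat_prod_list :: "nat \<Rightarrow> complex mat list \<Rightarrow> complex mat" where
  "mat_prod_list N As = foldr (*) As (1\<^sub>m N)"

definition std_complex_gaussian :: "'w measure \<Rightarrow> ('w \<Rightarrow> complex) \<Rightarrow> bool" where
  "std_complex_gaussian M Z \<longleftrightarrow>
     distributed M lborel (\<lambda>\<omega>. Re (Z \<omega>)) (normal_density 0 (sqrt (1/2))) \<and>
     distributed M lborel (\<lambda>\<omega>. Im (Z \<omega>)) (normal_density 0 (sqrt (1/2))) \<and>
     prob_space.indep_var M borel (\<lambda>\<omega>. Re (Z \<omega>)) borel (\<lambda>\<omega>. Im (Z \<omega>))"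

definition gaussian_mat :: "nat \<Rightarrow> (nat \<Rightarrow> nat \<Rightarrow> 'w \<Rightarrow> complex) \<Rightarrow> 'w \<Rightarrow> complex mat" where
  "gaussian_mat N f \<omega> = complex_of_real (1 / sqrt (real N)) \<cdot>\<^sub>m mat N N (\<lambda>(i, j). f i j \<omega>)"

definition gue_mat :: "nat \<Rightarrow> (nat \<Rightarrow> nat \<Rightarrow> 'w \<Rightarrow> complex) \<Rightarrow> 'w \<Rightarrow> complex mat" where
  "gue_mat N f \<omega> =
     complex_of_real (1 / sqrt 2) \<cdot>\<^sub>m (mat_adjoint (gaussian_mat N f \<omega>) + gaussian_mat N f \<omega>)"

definition permutation_mats :: "nat \<Rightarrow> complex mat set" where
  "permutation_mats N =
     {mat N N (\<lambda>(i, j). if i = p j then 1 else 0) | p. p permutes {..<N}}"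

text \<open>The Borel sigma-algebra on \<open>N \<times> N\<close> matrices: the one generated by the entries.\<close>

definition borel_mat :: "nat \<Rightarrow> complex mat measure" where
  "borel_mat N =
     vimage_algebra (carrier_mat N N) (\<lambda>A. \<lambda>ij\<in>{..<N} \<times> {..<N}. A $$ ij)
       (\<Pi>\<^sub>M ij\<in>{..<N} \<times> {..<N}. borel)"

end

theory Submission
  imports Defs "HOL-Real_Asymp.Real_Asymp"
begin

text \<open>Write \<open>X = U H\<close> with \<open>H\<close> a GUE matrix, and fix the permutation for the moment. Gaussian integration by
  parts gives a loop (Schwinger-Dyson) equation for expectations of products of normalized traces of
  words in \<open>H\<close>, \<open>U\<close> and \<open>U\<^sup>*\<close>: it removes two letters \<open>H\<close> and splits the word containing them into two
  traces, up to terms of order \<open>N\<^sup>-\<^sup>2\<close>. After averaging over the permutation, induction on the number of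
  letters \<open>H\<close> shows that every such expectation converges to a product of limits of single words; the
  induction starts with \<open>tr(U\<^sup>m)\<close>, which tends to \<open>0\<close> for \<open>m \<noteq> 0\<close> because a power of a random
  permutation has a bounded expected number of fixed points. Keeping track of the number of letters
  \<open>H\<close> and of the total exponent of \<open>U\<close>, the splittings that survive in a word in \<open>X\<close> and \<open>X\<^sup>*\<close> are those
  pairing an \<open>X\<close> with an \<open>X\<^sup>*\<close>. The resulting recursion is the one that the moment-cumulant formula
  gives for a circular element when the block of the first letter is split off.\<close>

section \<open>Non-crossing partitions into pairs\<close>

text \<open>Single traces do not form a closed system: cutting a word yields a product of two
  traces, and the expectation of a product is not the product of the expectations. Hence the
  unknowns are expectations over arbitrary lists of words, and asymptotic factorization comes out of
  the same induction, without a separate variance estimate. Every term of the loop equation has two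
  letters \<open>LH\<close> fewer, including the small one, which merges two words instead of
  cutting one. The equation is linear in the moments with coefficients independent of the
  permutation, so randomness of the permutation matters only in the base case; there all factors lie
  in [0, 1], and one word of non-zero charge makes the whole average small. The limits are defined
  by a recursion that always starts from the first \<open>LH\<close>, which hides their cyclic
  invariance. The comparison with circular moments must cancel a leading \<open>LUi\<close> against
  a trailing \<open>LU\<close>, so this invariance is carried over from finite
  \<open>N\<close>.\<close>

definition nc_on :: "nat set \<Rightarrow> nat set set set" where
  "nc_on S = {P. partition_on S P \<and> noncrossing P}"

text \<open>Arbitrary sets \<open>S\<close> are allowed because removing the block of the least
  point leaves sets that are no longer initial segments.\<close>

definition nc_sum :: "(nat set \<Rightarrow> complex) \<Rightarrow> nat set \<Rightarrow> complex" where
  "nc_sum w S = (\<Sum>P\<in>nc_on S. \<Prod>V\<in>P. w V)"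

lemma finite_nc_on: "finite S \<Longrightarrow> finite (nc_on S)"
  by (rule finite_subset[of _ "Pow (Pow S)"]) (auto simp: nc_on_def partition_on_def)

lemma nc_on_iff:
  "P \<in> nc_on S \<longleftrightarrow> \<Union>P = S \<and> disjoint P \<and> {} \<notin> P \<and> noncrossing P"
  by (auto simp: nc_on_def partition_on_def)

lemma noncrossingD:
  "noncrossing P \<Longrightarrow> V \<in> P \<Longrightarrow> W \<in> P \<Longrightarrow> V \<noteq> W \<Longrightarrow> p < q \<Longrightarrow> q < r \<Longrightarrow> r < s \<Longrightarrow>
    p \<in> V \<Longrightarrow> r \<in> V \<Longrightarrow> q \<in> W \<Longrightarrow> s \<in> W \<Longrightarrow> False"
  unfolding noncrossing_def by blast

lemma nc_sum_empty [simp]: "nc_sum w {} = 1"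
proof -
  have "nc_on {} = {{}}"
    by (auto simp: nc_on_def partition_on_def noncrossing_def)
  then show ?thesis by (simp add: nc_sum_def)
qed

text \<open>The two pieces lie on opposite sides of \<open>b\<close> and above \<open>a\<close>, so
  blocks of different pieces cannot cross, and no block has points both inside and outside the arc
  from \<open>a\<close> to \<open>b\<close>.\<close>

lemma nc_on_insert_pair:
  assumes "P1 \<in> nc_on (S \<inter> {a<..<b})" "P2 \<in> nc_on (S \<inter> {b<..})"
    and "a \<in> S" "b \<in> S" "a < b" and min: "\<And>x. x \<in> S \<Longrightarrow> a \<le> x"
  shows "insert {a, b} (P1 \<union> P2) \<in> nc_on S"
proof -
  have U1: "\<Union>P1 = S \<inter> {a<..<b}" and U2: "\<Union>P2 = S \<inter> {b<..}"
    and d: "disjoint P1" "disjoint P2" and e: "{} \<notin> P1" "{} \<notin> P2"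
    and n: "noncrossing P1" "noncrossing P2"
    using assms(1,2) by (simp_all add: nc_on_iff)
  have S: "S = {a, b} \<union> (S \<inter> {a<..<b}) \<union> (S \<inter> {b<..})"
  proof
    show "S \<subseteq> {a, b} \<union> (S \<inter> {a<..<b}) \<union> (S \<inter> {b<..})"
    proof
      fix x assume "x \<in> S"
      then show "x \<in> {a, b} \<union> (S \<inter> {a<..<b}) \<union> (S \<inter> {b<..})" using min[of x] by auto
    qed
  qed (use assms in auto)
  have m1: "a < x \<and> x < b" if "V \<in> P1" "x \<in> V" for V x
  proof -
    have "x \<in> S \<inter> {a<..<b}" using that unfolding U1[symmetric] by blast
    then show ?thesis by simp
  qed
  have m2: "b < x" if "V \<in> P2" "x \<in> V" for V x
  proof -
    have "x \<in> S \<inter> {b<..}" using that unfolding U2[symmetric] by blast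
    then show ?thesis by simp
  qed
  have mS: "x \<in> S" if "V \<in> insert {a, b} (P1 \<union> P2)" "x \<in> V" for V x
    using that U1 U2 assms(3,4) by blast
  have disj12: "V \<inter> W = {}" "W \<inter> V = {}" if "V \<in> P1" "W \<in> P2" for V W
    using m1[OF that(1)] m2[OF that(2)] by (meson disjoint_iff less_asym)+
  have disj0: "{a, b} \<inter> V = {}" "V \<inter> {a, b} = {}" if "V \<in> P1 \<or> V \<in> P2" for V
  proof -
    have "a < x \<and> x \<noteq> b" if "x \<in> V" for x
      using m1[of V x] m2[of V x] that \<open>V \<in> P1 \<or> V \<in> P2\<close> \<open>a < b\<close> by auto
    then show "{a, b} \<inter> V = {}" "V \<inter> {a, b} = {}" by blast+
  qed
  have "disjoint (insert {a, b} (P1 \<union> P2))"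
  proof (rule disjointI)
    fix V W assume "V \<in> insert {a, b} (P1 \<union> P2)" "W \<in> insert {a, b} (P1 \<union> P2)" "V \<noteq> W"
    then have "V = {a, b} \<or> V \<in> P1 \<or> V \<in> P2" "W = {a, b} \<or> W \<in> P1 \<or> W \<in> P2" by simp_all
    then show "V \<inter> W = {}"
      using \<open>V \<noteq> W\<close> disj12 disj0 disjointD[OF d(1)] disjointD[OF d(2)]
      by (elim disjE) (simp_all only: simp_thms)
  qed
  moreover have "\<Union>(insert {a, b} (P1 \<union> P2)) = S" using U1 U2 S by auto
  moreover have "noncrossing (insert {a, b} (P1 \<union> P2))"
    unfolding noncrossing_def
  proof (intro notI, elim bexE conjE exE)
    fix V W p q r s
    assume V: "V \<in> insert {a, b} (P1 \<union> P2)" and W: "W \<in> insert {a, b} (P1 \<union> P2)"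
      and ne: "V \<noteq> W" and lt: "p < q" "q < r" "r < s" and i: "p \<in> V" "r \<in> V" "q \<in> W" "s \<in> W"
    have pS: "a \<le> p" using mS[OF V i(1)] min by blast
    consider "V = {a, b}" "W \<in> P1" | "V = {a, b}" "W \<in> P2" | "V \<in> P1" "W \<in> P1"
      | "V \<in> P1" "W \<in> P2" | "V \<in> P2" "W \<in> P1" | "V \<in> P2" "W \<in> P2" | "W = {a, b}"
      using V W ne by blast
    then show False
    proof cases
      case 1 then show False using m1[of W s] i lt pS by auto
    next
      case 2 then show False using m2[of W q] i lt pS by auto
    next
      case 3 then show False using noncrossingD[OF n(1) _ _ ne lt] i by blast
    next
      case 4 then show False using m1[of V r] m2[of W q] i lt by auto
    next
      case 5 then show False using m2[of V p] m1[of W s] i lt by auto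
    next
      case 6 then show False using noncrossingD[OF n(2) _ _ ne lt] i by blast
    next
      \<comment> \<open>The smaller point \<open>q\<close> of the pair must be \<open>a\<close>, and
        nothing in \<open>S\<close> lies below \<open>a\<close>.\<close>
      case 7
      then have "q = a \<or> q = b" "s = a \<or> s = b" using i by auto
      then have "q = a" using lt \<open>a < b\<close> by auto
      then show False using pS lt by simp
    qed
  qed
  ultimately show ?thesis using e by (simp add: nc_on_iff)
qed

text \<open>A further block with points on both sides of \<open>b\<close> would cross
  \<open>{a, b}\<close>, since all its points exceed the minimum \<open>a\<close>.\<close>

lemma nc_on_remove_pair:
  assumes P: "P \<in> nc_on S" "{a, b} \<in> P" and "a < b" and min: "\<And>x. x \<in> S \<Longrightarrow> a \<le> x"
  defines "P1 \<equiv> {V \<in> P. V \<subseteq> {a<..<b}}" and "P2 \<equiv> {V \<in> P. V \<subseteq> {b<..}}"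
  shows "P1 \<in> nc_on (S \<inter> {a<..<b})" "P2 \<in> nc_on (S \<inter> {b<..})" "insert {a, b} (P1 \<union> P2) = P"
proof -
  have U: "\<Union>P = S" and d: "disjoint P" and e: "{} \<notin> P" and n: "noncrossing P"
    using P(1) by (simp_all add: nc_on_iff)
  have cov: "V = {a, b} \<or> V \<subseteq> {a<..<b} \<or> V \<subseteq> {b<..}" if V: "V \<in> P" for V
  proof (rule ccontr)
    assume *: "\<not> ?thesis"
    have dis: "V \<inter> {a, b} = {}" using disjointD[OF d V P(2)] * by blast
    have gt: "a < x" if "x \<in> V" for x
    proof -
      have "x \<in> S" using U V that by blast
      then have "a \<le> x" by (rule min)
      moreover have "x \<noteq> a" using dis that by blast
      ultimately show ?thesis by simp
    qed
    obtain y where y: "y \<in> V" "\<not> y < b" using * gt by force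
    obtain x where x: "x \<in> V" "\<not> b < x" using * gt by force
    have "x \<noteq> b" "y \<noteq> b" using dis x y by auto
    then have "a < x" "x < b" "b < y" using gt[OF x(1)] x y by auto
    then show False using noncrossingD[OF n P(2) V, of a x b y] * x y by auto
  qed
  have part: "{V \<in> P. V \<subseteq> T} \<in> nc_on (S \<inter> T)" if T: "\<And>V. V \<in> P \<Longrightarrow> V \<subseteq> T \<or> V \<inter> T = {}" for T
  proof -
    have "\<Union>{V \<in> P. V \<subseteq> T} = S \<inter> T" using U T by blast
    moreover have "disjoint {V \<in> P. V \<subseteq> T}" using d unfolding disjoint_def by blast
    moreover have "noncrossing {V \<in> P. V \<subseteq> T}" using n unfolding noncrossing_def by blast
    ultimately show ?thesis using e by (simp add: nc_on_iff)
  qed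
  show "P1 \<in> nc_on (S \<inter> {a<..<b})" unfolding P1_def
    by (rule part) (use cov \<open>a < b\<close> in fastforce)
  show "P2 \<in> nc_on (S \<inter> {b<..})" unfolding P2_def
    by (rule part) (use cov \<open>a < b\<close> in fastforce)
  show "insert {a, b} (P1 \<union> P2) = P" using cov P(2) unfolding P1_def P2_def by blast
qed

lemma sum_nc_on_pair:
  assumes S: "finite S" "a \<in> S" "b \<in> S" "a < b" and min: "\<And>x. x \<in> S \<Longrightarrow> a \<le> x"
  shows "(\<Sum>P | P \<in> nc_on S \<and> {a, b} \<in> P. \<Prod>V\<in>P. w V) =
    w {a, b} * nc_sum w (S \<inter> {a<..<b}) * nc_sum w (S \<inter> {b<..})"
proof -
  let ?S1 = "S \<inter> {a<..<b}" and ?S2 = "S \<inter> {b<..}"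
  have "(\<Sum>P | P \<in> nc_on S \<and> {a, b} \<in> P. \<Prod>V\<in>P. w V) =
    (\<Sum>(P1, P2)\<in>nc_on ?S1 \<times> nc_on ?S2. w {a, b} * (\<Prod>V\<in>P1. w V) * (\<Prod>V\<in>P2. w V))"
  proof (rule sum.reindex_bij_witness[where
        j = "\<lambda>P. ({V \<in> P. V \<subseteq> {a<..<b}}, {V \<in> P. V \<subseteq> {b<..}})" and
        i = "\<lambda>(P1, P2). insert {a, b} (P1 \<union> P2)"], goal_cases)
    case (1 P) then show ?case using nc_on_remove_pair(3)[of P S a b] S min by simp
  next
    case (2 P) then show ?case using nc_on_remove_pair[of P S a b] S min by simp
  next
    case (3 Q)
    obtain P1 P2 where Q: "Q = (P1, P2)" by (cases Q)
    have "\<Union>P1 = ?S1" "\<Union>P2 = ?S2" "{} \<notin> P1" "{} \<notin> P2"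
      using 3 Q by (simp_all add: nc_on_iff)
    then have 1: "V \<noteq> {}" "V \<subseteq> {a<..<b}" if "V \<in> P1" for V
      using that by (blast, blast)
    have 2: "V \<noteq> {}" "V \<subseteq> {b<..}" if "V \<in> P2" for V
      using that \<open>\<Union>P2 = ?S2\<close> \<open>{} \<notin> P2\<close> by (blast, blast)
    \<comment> \<open>The empty set satisfies both inclusions; excluding empty blocks is what makes
      the two pieces recoverable from their union.\<close>
    have 3: "\<not> (V \<subseteq> {a<..<b} \<and> V \<subseteq> {b<..})" if "V \<noteq> {}" for V
      using that by fastforce
    have 4: "\<not> V \<subseteq> {b<..}" if "V \<in> P1" for V
      using 1(1)[OF that] 1(2)[OF that] 3[of V] by blast
    have 5: "\<not> V \<subseteq> {a<..<b}" if "V \<in> P2" for V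
      using 2(1)[OF that] 2(2)[OF that] 3[of V] by blast
    have 6: "\<not> {a, b} \<subseteq> {a<..<b}" "\<not> {a, b} \<subseteq> {b<..}"
      using \<open>a < b\<close> by auto
    have "{V \<in> insert {a, b} (P1 \<union> P2). V \<subseteq> {a<..<b}} = P1"
      using 1(2) 5 6(1) by blast
    moreover have "{V \<in> insert {a, b} (P1 \<union> P2). V \<subseteq> {b<..}} = P2"
      using 2(2) 4 6(2) by blast
    ultimately show ?case using Q by simp
  next
    case (4 Q) then show ?case using nc_on_insert_pair S min by auto
  next
    case (5 P)
    let ?P1 = "{V \<in> P. V \<subseteq> {a<..<b}}" and ?P2 = "{V \<in> P. V \<subseteq> {b<..}}"
    have r: "?P1 \<in> nc_on ?S1" "?P2 \<in> nc_on ?S2" "insert {a, b} (?P1 \<union> ?P2) = P"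
      using nc_on_remove_pair[of P S a b] 5 S min by auto
    have fin: "finite P" using 5 S finite_elements by (auto simp: nc_on_def)
    have e: "{} \<notin> P" using 5 by (simp add: nc_on_iff)
    have disj: "?P1 \<inter> ?P2 = {}"
    proof (rule equals0I)
      fix V assume V: "V \<in> ?P1 \<inter> ?P2"
      then have "V \<noteq> {}" using e by blast
      then obtain x where "x \<in> V" by blast
      then have "x < b" "b < x" using V by auto
      then show False by simp
    qed
    have "(\<Prod>V\<in>P. w V) = (\<Prod>V\<in>insert {a, b} (?P1 \<union> ?P2). w V)" using r(3) by simp
    also have "\<dots> = w {a, b} * (\<Prod>V\<in>?P1 \<union> ?P2. w V)"
      by (rule prod.insert) (use fin in auto)
    also have "(\<Prod>V\<in>?P1 \<union> ?P2. w V) = (\<Prod>V\<in>?P1. w V) * (\<Prod>V\<in>?P2. w V)"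
      by (rule prod.union_disjoint) (use fin disj in auto)
    finally show ?case by (simp add: mult.assoc)
  qed
  also have "\<dots> = w {a, b} * nc_sum w ?S1 * nc_sum w ?S2"
    unfolding nc_sum_def sum.cartesian_product[symmetric]
    unfolding mult.assoc sum_product by (simp add: sum_distrib_left)
  finally show ?thesis .
qed

text \<open>If only two-element blocks have non-zero weight, the partner \<open>b\<close> of the least element \<open>a\<close>
  separates a non-crossing partition into one of the points between \<open>a\<close> and \<open>b\<close> and one of the
  points beyond \<open>b\<close>.\<close>

lemma nc_sum_rec:
  assumes w: "\<And>V. w V \<noteq> 0 \<Longrightarrow> \<exists>p q. p \<noteq> q \<and> V = {p, q}"
    and S: "finite S" "a \<in> S" and min: "\<And>x. x \<in> S \<Longrightarrow> a \<le> x"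
  shows "nc_sum w S =
    (\<Sum>b\<in>S \<inter> {a<..}. w {a, b} * nc_sum w (S \<inter> {a<..<b}) * nc_sum w (S \<inter> {b<..}))"
proof -
  let ?B = "\<lambda>b. {P \<in> nc_on S. {a, b} \<in> P}"
  have fin: "finite P" if "P \<in> nc_on S" for P
    using that S finite_elements by (auto simp: nc_on_def)
  have "nc_sum w S = (\<Sum>P\<in>(\<Union>b\<in>S \<inter> {a<..}. ?B b). \<Prod>V\<in>P. w V)"
    unfolding nc_sum_def
  proof (rule sum.mono_neutral_right[OF finite_nc_on[OF S(1)]], blast, rule ballI)
    fix P assume P: "P \<in> nc_on S - (\<Union>b\<in>S \<inter> {a<..}. ?B b)"
    then have U: "\<Union>P = S" by (simp add: nc_on_iff)
    then obtain V where V: "V \<in> P" "a \<in> V" using S by blast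
    have "w V = 0"
    proof (rule ccontr)
      assume "w V \<noteq> 0"
      then obtain p q where pq: "p \<noteq> q" "V = {p, q}" using w by blast
      then obtain b where b: "V = {a, b}" "a \<noteq> b" using V by blast
      then have "b \<in> S" using U V by blast
      then have "b \<in> S \<inter> {a<..}" using min[of b] b by auto
      then show False using P V b by auto
    qed
    then show "(\<Prod>V\<in>P. w V) = 0" using V fin P by (auto intro!: prod_zero)
  qed
  also have "\<dots> = (\<Sum>b\<in>S \<inter> {a<..}. \<Sum>P\<in>?B b. \<Prod>V\<in>P. w V)"
  proof (rule sum.UNION_disjoint)
    show "\<forall>b\<in>S \<inter> {a<..}. \<forall>c\<in>S \<inter> {a<..}. b \<noteq> c \<longrightarrow> ?B b \<inter> ?B c = {}"
    proof (intro ballI impI equals0I)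
      fix b c P assume bc: "b \<in> S \<inter> {a<..}" "c \<in> S \<inter> {a<..}" "b \<noteq> c" and P: "P \<in> ?B b \<inter> ?B c"
      then have "disjoint P" "{a, b} \<in> P" "{a, c} \<in> P" by (simp_all add: nc_on_iff)
      moreover have "{a, b} \<noteq> {a, c}" using bc by (auto simp: doubleton_eq_iff)
      ultimately show False using disjointD[of P "{a, b}" "{a, c}"] by blast
    qed
  qed (use S finite_nc_on in auto)
  also have "\<dots> = (\<Sum>b\<in>S \<inter> {a<..}. w {a, b} * nc_sum w (S \<inter> {a<..<b}) * nc_sum w (S \<inter> {b<..}))"
    by (intro sum.cong refl sum_nc_on_pair) (use S min in auto)
  finally show ?thesis .
qed

section \<open>Moments of a circular element\<close>

lemma nths_single_index: "i < length xs \<Longrightarrow> nths xs {i} = [xs ! i]"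
proof (induction xs arbitrary: i)
  case (Cons x xs)
  show ?case
  proof (cases i)
    case 0 then show ?thesis by (simp add: nths_Cons)
  next
    case (Suc k)
    then have "{j. Suc j \<in> {i}} = {k}" by auto
    then show ?thesis using Suc Cons by (simp add: nths_Cons)
  qed
qed simp

lemma nths_two_indices: "p < q \<Longrightarrow> q < length xs \<Longrightarrow> nths xs {p, q} = [xs ! p, xs ! q]"
proof (induction xs arbitrary: p q)
  case (Cons x xs)
  obtain l where q: "q = Suc l" using Cons.prems(1) by (cases q) auto
  show ?case
  proof (cases p)
    case 0
    then have "{j. Suc j \<in> {p, q}} = {l}" using q by auto
    then show ?thesis using 0 q Cons.prems by (simp add: nths_Cons nths_single_index)
  next
    case (Suc k)
    then have "{j. Suc j \<in> {p, q}} = {k, l}" using q by auto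
    then show ?thesis using Suc q Cons by (simp add: nths_Cons)
  qed
qed simp

text \<open>The circular cumulant of the block \<open>V\<close>, expressed through positions: the
  two admissible words \<open>[Plain, Star]\<close> and \<open>[Star, Plain]\<close> become the
  single condition that the exponents differ.\<close>

definition circ_weight :: "star_exponent list \<Rightarrow> nat set \<Rightarrow> complex" where
  "circ_weight es V =
    (if \<exists>p q. p < q \<and> q < length es \<and> V = {p, q} \<and> es ! p \<noteq> es ! q then 1 else 0)"

lemma circ_weight_pair:
  assumes "p < q" "q < length es"
  shows "circ_weight es {p, q} = (if es ! p \<noteq> es ! q then 1 else 0)"
proof -
  have "(\<exists>p' q'. p' < q' \<and> q' < length es \<and> {p, q} = {p', q'} \<and> es ! p' \<noteq> es ! q') \<longleftrightarrow> es ! p \<noteq> es ! q"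
    using assms by (auto simp: doubleton_eq_iff)
  then show ?thesis by (simp add: circ_weight_def)
qed

lemma free_cumulant_circular:
  assumes circ: "standard_circular star \<phi> X" and V: "V \<subseteq> {..<length es}" "V \<noteq> {}"
  shows "free_cumulant \<phi> (nths (map (star_pow star X) es) V) = circ_weight es V"
proof -
  let ?l = "nths es V"
  have len: "length ?l = card V"
    unfolding length_nths by (rule arg_cong[where f = card]) (use V in auto)
  have finV: "finite V" using V finite_subset by blast
  then have "?l \<noteq> []" using V len by auto
  then have fc: "free_cumulant \<phi> (nths (map (star_pow star X) es) V) =
      (if ?l = [Plain, Star] \<or> ?l = [Star, Plain] then 1 else 0)"
    using circ unfolding standard_circular_def nths_map by blast
  have "?l = [Plain, Star] \<or> ?l = [Star, Plain] \<longleftrightarrow>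
    (\<exists>p q. p < q \<and> q < length es \<and> V = {p, q} \<and> es ! p \<noteq> es ! q)" (is "?L \<longleftrightarrow> ?R")
  proof
    assume L: ?L
    then have "card V = 2" using len by auto
    then obtain x y where "V = {x, y}" "x \<noteq> y" by (auto simp: card_2_iff)
    then obtain p q where pq: "V = {p, q}" "p < q" by (metis insert_commute linorder_neqE_nat)
    then have "q < length es" using V by auto
    then have "?l = [es ! p, es ! q]" using pq nths_two_indices by blast
    then have "es ! p \<noteq> es ! q" using L by auto
    then show ?R using pq \<open>q < length es\<close> by blast
  next
    assume ?R
    then obtain p q where pq: "p < q" "q < length es" "V = {p, q}" "es ! p \<noteq> es ! q" by blast
    then have "?l = [es ! p, es ! q]" using nths_two_indices by blast
    then show ?L using pq(4) by (cases "es ! p"; cases "es ! q") auto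
  qed
  then show ?thesis unfolding fc circ_weight_def by simp
qed

text \<open>Splitting off the block of the first letter gives the non-crossing sum the same
  recursion as \<open>C\<close>, and the recursion determines its solution. The random matrix limits
  enter later as an instance of \<open>C\<close>.\<close>

lemma circular_moment_eq:
  fixes C :: "star_exponent list \<Rightarrow> complex"
  assumes circ: "standard_circular star \<phi> X" and "es \<noteq> []"
    and C_Nil: "C [] = 1"
    and C_Cons: "\<And>e es. C (e # es) =
      (\<Sum>b<length es. if es ! b \<noteq> e then C (take b es) * C (drop (Suc b) es) else 0)"
  shows "\<phi> (prod_list (map (star_pow star X) es)) = C es"
proof -
  let ?n = "length es" and ?w = "circ_weight es"
  have w_pair: "\<exists>p q. p \<noteq> q \<and> V = {p, q}" if "?w V \<noteq> 0" for V
    using that unfolding circ_weight_def by (metis less_irrefl)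
  \<comment> \<open>Intervals of positions are closed under the splitting, and each corresponds to a
    contiguous subword; the induction is on their length.\<close>
  have C_eq: "nc_sum ?w {x..<y} = C (take (y - x) (drop x es))" if "y \<le> ?n" for x y
    using that
  proof (induction "y - x" arbitrary: x y rule: less_induct)
    case less
    show ?case
    proof (cases "x < y")
      case False
      then show ?thesis by (simp add: C_Nil)
    next
      case True
      let ?l = "take (y - Suc x) (drop (Suc x) es)"
      have list: "take (y - x) (drop x es) = es ! x # ?l"
        using True less.prems by (simp add: Cons_nth_drop_Suc[symmetric] Suc_diff_Suc[symmetric])
      have len: "length ?l = y - Suc x" using less.prems by simp
      have "nc_sum ?w {x..<y} = (\<Sum>b\<in>{x..<y} \<inter> {x<..}. ?w {x, b} *
          nc_sum ?w ({x..<y} \<inter> {x<..<b}) * nc_sum ?w ({x..<y} \<inter> {b<..}))"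
        by (rule nc_sum_rec) (use w_pair True in auto)
      also have "\<dots> = (\<Sum>b\<in>{Suc x..<y}. ?w {x, b} * nc_sum ?w {Suc x..<b} * nc_sum ?w {Suc b..<y})"
      proof (rule sum.cong)
        fix b assume b: "b \<in> {Suc x..<y}"
        then have "{x..<y} \<inter> {x<..<b} = {Suc x..<b}" "{x..<y} \<inter> {b<..} = {Suc b..<y}" by auto
        then show "?w {x, b} * nc_sum ?w ({x..<y} \<inter> {x<..<b}) * nc_sum ?w ({x..<y} \<inter> {b<..}) =
          ?w {x, b} * nc_sum ?w {Suc x..<b} * nc_sum ?w {Suc b..<y}" by (simp only:)
      qed auto
      also have "\<dots> = (\<Sum>b\<in>{Suc x..<y}. if es ! b \<noteq> es ! x then
          C (take (b - Suc x) (drop (Suc x) es)) * C (take (y - Suc b) (drop (Suc b) es)) else 0)"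
      proof (rule sum.cong[OF refl])
        fix b assume b: "b \<in> {Suc x..<y}"
        have "nc_sum ?w {Suc x..<b} = C (take (b - Suc x) (drop (Suc x) es))"
          by (rule less.hyps) (use b less.prems in auto)
        moreover have "nc_sum ?w {Suc b..<y} = C (take (y - Suc b) (drop (Suc b) es))"
          by (rule less.hyps) (use b less.prems in auto)
        moreover have "?w {x, b} = (if es ! b \<noteq> es ! x then 1 else 0)"
          using circ_weight_pair[of x b es] b less.prems by auto
        ultimately show "?w {x, b} * nc_sum ?w {Suc x..<b} * nc_sum ?w {Suc b..<y} =
            (if es ! b \<noteq> es ! x then
          C (take (b - Suc x) (drop (Suc x) es)) * C (take (y - Suc b) (drop (Suc b) es)) else 0)"
          by simp
      qed
      also have "\<dots> = (\<Sum>b<length ?l. if ?l ! b \<noteq> es ! x then C (take b ?l) * C (drop (Suc b) ?l) else 0)"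
      proof (rule sum.reindex_bij_witness[where i = "\<lambda>b. b + Suc x" and j = "\<lambda>b. b - Suc x"])
        fix b assume b: "b \<in> {Suc x..<y}"
        define c where "c = b - Suc x"
        have c: "b = Suc x + c" using b by (simp add: c_def)
        show "(if ?l ! (b - Suc x) \<noteq> es ! x then C (take (b - Suc x) ?l) * C (drop (Suc (b - Suc x)) ?l) else 0)
          = (if es ! b \<noteq> es ! x then
          C (take (b - Suc x) (drop (Suc x) es)) * C (take (y - Suc b) (drop (Suc b) es)) else 0)"
          using b c less.prems by (simp add: drop_take min_def add.commute)
      qed (use len in auto)
      also have "\<dots> = C (take (y - x) (drop x es))" unfolding list by (rule C_Cons[symmetric])
      finally show ?thesis .
    qed
  qed
  have "\<phi> (prod_list (map (star_pow star X) es)) =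
      (\<Sum>P\<in>NC ?n. \<Prod>V\<in>P. free_cumulant \<phi> (nths (map (star_pow star X) es) V))"
    using free_cumulant_moment[of "map (star_pow star X) es" \<phi>] \<open>es \<noteq> []\<close> by simp
  also have "\<dots> = (\<Sum>P\<in>NC ?n. \<Prod>V\<in>P. ?w V)"
  proof (intro sum.cong prod.cong refl)
    fix P V assume PV: "P \<in> NC ?n" "V \<in> P"
    then have "V \<noteq> {}" by (auto simp: NC_def partition_on_def)
    then show "free_cumulant \<phi> (nths (map (star_pow star X) es) V) = ?w V"
      using free_cumulant_circular[OF circ] NC_block_subset[OF PV] by blast
  qed
  also have "\<dots> = nc_sum ?w {0..<?n}"
    unfolding nc_sum_def nc_on_def NC_def lessThan_atLeast0 ..
  also have "\<dots> = C es" using C_eq[of ?n 0] by simp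
  finally show ?thesis .
qed

section \<open>Fixed points of powers of a random permutation\<close>

text \<open>Composing a permutation whose cycle through \<open>i\<close> has length \<open>d\<close> with a transposition
  \<open>(i j)\<close>, \<open>j\<close> outside that cycle, gives a permutation whose \<open>d\<close>-th power maps \<open>i\<close> to \<open>j\<close>; hence
  the pair can be recovered from the composition.\<close>

lemma card_permutes_period_le:
  assumes S: "finite S" "i \<in> S" and d: "d > 0"
  defines "A \<equiv> {p. p permutes S \<and> (p ^^ d) i = i \<and> (\<forall>e. 0 < e \<and> e < d \<longrightarrow> (p ^^ e) i \<noteq> i)}"
  shows "card A * (card S - d) \<le> fact (card S)"
proof -
  define orb where "orb p = (\<lambda>e. (p ^^ e) i) ` {..<d}" for p :: "'a \<Rightarrow> 'a"
  define F where "F = (\<lambda>(p :: 'a \<Rightarrow> 'a, j). Transposition.transpose i j \<circ> p)"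
  have finA: "finite A"
    by (rule finite_subset[OF _ finite_permutations[OF S(1)]]) (auto simp: A_def)
  \<comment> \<open>Before time \<open>d\<close> the orbit of \<open>i\<close> under
    \<open>p\<close> meets neither \<open>i\<close> again nor \<open>j\<close>, so the transposition
    has no effect; at time \<open>d\<close> it turns the return to \<open>i\<close> into
    \<open>j\<close>.\<close>
  have pow: "(F (p, j) ^^ d) i = j" if p: "p \<in> A" and j: "j \<in> S - orb p" for p j
  proof -
    have j_ne: "(p ^^ e) i \<noteq> j" if "e < d" for e using j that by (auto simp: orb_def)
    have "(F (p, j) ^^ e) i = (p ^^ e) i" if "e < d" for e
      using that
    proof (induction e)
      case (Suc e)
      then have "(p ^^ Suc e) i \<noteq> i" "(p ^^ Suc e) i \<noteq> j"
        using p j_ne by (auto simp: A_def simp del: funpow.simps)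
      then show ?case using Suc by (simp add: F_def)
    qed simp
    moreover obtain c where c: "d = Suc c" using d gr0_implies_Suc by blast
    ultimately have "(F (p, j) ^^ d) i = Transposition.transpose i j ((p ^^ d) i)"
      by (simp add: F_def)
    then show ?thesis using p by (simp add: A_def)
  qed
  have "inj_on F (Sigma A (\<lambda>p. S - orb p))"
  proof (rule inj_onI, clarify)
    fix p j q k
    assume *: "p \<in> A" "j \<in> S" "j \<notin> orb p" "q \<in> A" "k \<in> S" "k \<notin> orb q" "F (p, j) = F (q, k)"
    then have jk: "j = k" using pow[of p j] pow[of q k] by simp
    have "Transposition.transpose i j \<circ> (Transposition.transpose i j \<circ> p) = Transposition.transpose i j \<circ> (Transposition.transpose i j \<circ> q)"
      using * jk by (simp add: F_def)
    then show "p = q \<and> j = k" using jk by (simp add: o_assoc)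
  qed
  moreover have "F ` Sigma A (\<lambda>p. S - orb p) \<subseteq> {p. p permutes S}"
    using S by (auto simp: F_def A_def intro!: permutes_compose permutes_swap_id)
  ultimately have "card (Sigma A (\<lambda>p. S - orb p)) \<le> card {p. p permutes S}"
    by (rule card_inj_on_le) (use S finite_permutations in auto)
  also have "\<dots> = fact (card S)" using S by (simp add: card_permutations)
  finally have "(\<Sum>p\<in>A. card (S - orb p)) \<le> fact (card S)"
    using finA S by simp
  moreover have "card S - d \<le> card (S - orb p)" for p
  proof -
    have "card (orb p) \<le> d" unfolding orb_def by (metis card_image_le card_lessThan finite_lessThan)
    then show ?thesis using diff_card_le_card_Diff[of "orb p" S] by (simp add: orb_def)
  qed
  then have "card A * (card S - d) \<le> (\<Sum>p\<in>A. card (S - orb p))"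
    using sum_bounded_below[of A "card S - d" "\<lambda>p. card (S - orb p)"] by simp
  ultimately show ?thesis by linarith
qed

text \<open>The least period of a fixed point of the power is one of \<open>1, ..., m\<close>. Each
  period contributes at most \<open>fact (card S)\<close> after weakening \<open>card S - d\<close>
  to \<open>card S - m\<close>, whence the factor \<open>m\<close>.\<close>

lemma card_permutes_funpow_fixed_le:
  assumes S: "finite S" "i \<in> S" and m: "m > 0" "m < card S"
  shows "card {p. p permutes S \<and> (p ^^ m) i = i} * (card S - m) \<le> m * fact (card S)"
proof -
  let ?A = "\<lambda>d. {p. p permutes S \<and> (p ^^ d) i = i \<and> (\<forall>e. 0 < e \<and> e < d \<longrightarrow> (p ^^ e) i \<noteq> i)}"
  have fin: "finite (?A d)" for d
    by (rule finite_subset[OF _ finite_permutations[OF S(1)]]) auto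
  have "{p. p permutes S \<and> (p ^^ m) i = i} \<subseteq> (\<Union>d\<in>{1..m}. ?A d)"
  proof
    fix p assume p: "p \<in> {p. p permutes S \<and> (p ^^ m) i = i}"
    define d where "d = (LEAST d. d > 0 \<and> (p ^^ d) i = i)"
    have ex: "m > 0 \<and> (p ^^ m) i = i" using p m by simp
    have "d > 0 \<and> (p ^^ d) i = i" unfolding d_def by (rule LeastI[of _ m]) (rule ex)
    moreover have "d \<le> m" unfolding d_def by (rule Least_le) (rule ex)
    moreover have "(p ^^ e) i \<noteq> i" if "0 < e" "e < d" for e
      using not_less_Least[of e "\<lambda>d. d > 0 \<and> (p ^^ d) i = i"] that unfolding d_def by blast
    ultimately show "p \<in> (\<Union>d\<in>{1..m}. ?A d)" using p by (auto intro!: bexI[of _ d])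
  qed
  then have "card {p. p permutes S \<and> (p ^^ m) i = i} \<le> card (\<Union>d\<in>{1..m}. ?A d)"
    by (rule card_mono[rotated]) (use fin in blast)
  also have "\<dots> \<le> (\<Sum>d\<in>{1..m}. card (?A d))" by (rule card_UN_le) simp
  finally have "card {p. p permutes S \<and> (p ^^ m) i = i} * (card S - m)
      \<le> (\<Sum>d\<in>{1..m}. card (?A d)) * (card S - m)" by (rule mult_le_mono1)
  also have "\<dots> = (\<Sum>d\<in>{1..m}. card (?A d) * (card S - m))" by (rule sum_distrib_right)
  also have "\<dots> \<le> (\<Sum>d\<in>{1..m}. fact (card S))"
  proof (rule sum_mono)
    fix d assume d: "d \<in> {1..m}"
    then have "card (?A d) * (card S - m) \<le> card (?A d) * (card S - d)"
      by (intro mult_le_mono2) auto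
    also have "\<dots> \<le> fact (card S)" using d by (intro card_permutes_period_le S) auto
    finally show "card (?A d) * (card S - m) \<le> fact (card S)" .
  qed
  finally show ?thesis by simp
qed

text \<open>Double counting of pairs of a permutation and a fixed point: each of the
  \<open>N\<close> points is fixed by a proportion of at most \<open>m / (N - m)\<close> of the
  permutations.\<close>

lemma average_fixed_points_tendsto_0:
  assumes m: "m > 0"
  shows "(\<lambda>N. (\<Sum>p | p permutes {..<N}. real (card {i. i < N \<and> (p ^^ m) i = i}) / real N) / fact N)
    \<longlonglongrightarrow> 0"
proof (rule tendsto_sandwich[OF _ _ tendsto_const])
  show "\<forall>\<^sub>F N in sequentially. 0 \<le> (\<Sum>p | p permutes {..<N}. real (card {i. i < N \<and> (p ^^ m) i = i}) / real N) / fact N"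
    by (auto intro!: always_eventually divide_nonneg_nonneg sum_nonneg)
  show "\<forall>\<^sub>F N in sequentially. (\<Sum>p | p permutes {..<N}. real (card {i. i < N \<and> (p ^^ m) i = i}) / real N) / fact N
    \<le> real m / (real N - real m)"
  proof (rule eventually_sequentiallyI[of "Suc m"])
    fix N assume N: "Suc m \<le> N"
    have fin: "finite {p. p permutes {..<N}}" by (rule finite_permutations) simp
    have "(\<Sum>p | p permutes {..<N}. card {i. i < N \<and> (p ^^ m) i = i})
      = (\<Sum>p | p permutes {..<N}. \<Sum>i | i < N \<and> (p ^^ m) i = i. 1)" by simp
    also have "\<dots> = (\<Sum>p | p permutes {..<N}. \<Sum>i<N. if (p ^^ m) i = i then 1 else 0)"
      by (intro sum.cong refl sum.mono_neutral_cong_left) auto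
    also have "\<dots> = (\<Sum>i<N. \<Sum>p | p permutes {..<N}. if (p ^^ m) i = i then 1 else 0)"
      by (rule sum.swap)
    also have "\<dots> = (\<Sum>i<N. card {p. p permutes {..<N} \<and> (p ^^ m) i = i})"
      using fin by (simp add: sum.If_cases Int_def)
    finally have eq: "(\<Sum>p | p permutes {..<N}. card {i. i < N \<and> (p ^^ m) i = i}) =
      (\<Sum>i<N. card {p. p permutes {..<N} \<and> (p ^^ m) i = i})" .
    have "(\<Sum>p | p permutes {..<N}. card {i. i < N \<and> (p ^^ m) i = i}) * (N - m) =
      (\<Sum>i<N. card {p. p permutes {..<N} \<and> (p ^^ m) i = i} * (N - m))"
      unfolding eq by (rule sum_distrib_right)
    also have "\<dots> \<le> (\<Sum>i<N. m * fact N)"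
      by (rule sum_mono) (use card_permutes_funpow_fixed_le[of "{..<N}" _ m] m N in simp)
    finally have "(\<Sum>p | p permutes {..<N}. card {i. i < N \<and> (p ^^ m) i = i}) * (N - m)
      \<le> N * (m * fact N)" by simp
    then have "real ((\<Sum>p | p permutes {..<N}. card {i. i < N \<and> (p ^^ m) i = i}) * (N - m))
      \<le> real (N * (m * fact N))" by (rule of_nat_mono)
    then have "(\<Sum>p | p permutes {..<N}. real (card {i. i < N \<and> (p ^^ m) i = i})) * (real N - real m)
      \<le> real N * (real m * fact N)" using N by simp
    then show "(\<Sum>p | p permutes {..<N}. real (card {i. i < N \<and> (p ^^ m) i = i}) / real N) / fact N
      \<le> real m / (real N - real m)"
      using N by (simp add: sum_divide_distrib[symmetric] field_simps)
  qed
  show "(\<lambda>N. real m / (real N - real m)) \<longlonglongrightarrow> 0" by real_asymp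
qed

section \<open>Gaussian integration by parts\<close>

definition gauss_moment :: "nat \<Rightarrow> real" where
  "gauss_moment k = (\<integral>x. normal_density 0 (sqrt (1/2)) x * x ^ k \<partial>lborel)"

lemma gauss_moment_even: "gauss_moment (2 * k) = fact (2 * k) / (4 ^ k * fact k)"
  using integral_normal_moment_even[of "sqrt (1/2)" 0 k] by (simp add: gauss_moment_def)

lemma gauss_moment_odd: "gauss_moment (2 * k + 1) = 0"
  using integral_normal_moment_odd[of "sqrt (1/2)" 0 k] by (simp add: gauss_moment_def)

text \<open>One-variable integration by parts, with factor 1/2 the variance; it is read off from the
  closed formulas for the moments. At \<open>k = 0\<close> the coefficient vanishes, so the
  truncated \<open>k - 1\<close> is harmless.\<close>

lemma gauss_moment_Suc: "gauss_moment (Suc k) = real k / 2 * gauss_moment (k - 1)"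
proof (cases "even k")
  case True
  then obtain j where j: "k = 2 * j" by blast
  have "gauss_moment (k - 1) = 0 \<or> k = 0"
    using j gauss_moment_odd[of "j - 1"] by (cases j) auto
  then show ?thesis using j gauss_moment_odd[of j] by auto
next
  case False
  then obtain j where j: "k = 2 * j + 1" using oddE by blast
  have "gauss_moment (2 * Suc j) = (2 * real j + 1) / 2 * gauss_moment (2 * j)"
  proof -
    \<comment> \<open>The factor \<open>j + 1\<close> occurs in both the new factorial of
      \<open>2 * j + 2\<close> and the new denominator, and cancels.\<close>
    define c where "c = real j + 1"
    have c: "c > 0" by (simp add: c_def)
    have "gauss_moment (2 * Suc j) =
        (2 * c * (2 * real j + 1) * fact (2 * j)) / (4 * c * (4 ^ j * fact j))"
      unfolding gauss_moment_even by (simp add: c_def algebra_simps)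
    also have "\<dots> = (2 * real j + 1) / 2 * (fact (2 * j) / (4 ^ j * fact j))"
      using c by (simp add: divide_simps)
    finally show ?thesis by (simp only: gauss_moment_even)
  qed
  then show ?thesis using j by simp
qed

lemma (in prob_space) gauss_moment_expectation:
  assumes "distributed M lborel X (normal_density 0 (sqrt (1/2)))"
  shows "integrable M (\<lambda>\<omega>. X \<omega> ^ k)" "expectation (\<lambda>\<omega>. X \<omega> ^ k) = gauss_moment k"
proof -
  have "integrable lborel (\<lambda>x. normal_density 0 (sqrt (1/2)) x * x ^ k)"
    using integrable_normal_moment[of "sqrt (1/2)" 0 k] by simp
  then show "integrable M (\<lambda>\<omega>. X \<omega> ^ k)"
    using distributed_integrable[OF assms, of "\<lambda>x. x ^ k"] by simp
  show "expectation (\<lambda>\<omega>. X \<omega> ^ k) = gauss_moment k"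
    using distributed_integral[OF assms, of "\<lambda>x. x ^ k"] by (simp add: gauss_moment_def)
qed

section \<open>Polynomials in finitely many independent complex Gaussians\<close>

locale gaussian_entries = prob_space M for M :: "'w measure" +
  fixes I :: "'i set" and f :: "'i \<Rightarrow> 'w \<Rightarrow> complex"
  assumes fin: "finite I"
    and indep_f: "indep_vars (\<lambda>_. borel) f I"
    and gauss_f: "\<And>i. i \<in> I \<Longrightarrow> std_complex_gaussian M (f i)"
begin

abbreviation "T \<equiv> I \<times> (UNIV :: bool set)"

text \<open>The flag \<open>True\<close> selects the real and \<open>False\<close> the imaginary
  part. The real value is embedded into the complex numbers because the coefficients of the
  polynomials are complex.\<close>

definition part :: "'i \<times> bool \<Rightarrow> 'w \<Rightarrow> complex" where
  "part t \<omega> = complex_of_real (if snd t then Re (f (fst t) \<omega>) else Im (f (fst t) \<omega>))"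

text \<open>Factors are grouped by entry: independence of the entries separates the groups, and
  independence of real and imaginary part separates the two factors within a group.\<close>

lemma expectation_part_powers:
  "integrable M (\<lambda>\<omega>. \<Prod>t\<in>T. part t \<omega> ^ k t)"
  "expectation (\<lambda>\<omega>. \<Prod>t\<in>T. part t \<omega> ^ k t) = (\<Prod>t\<in>T. complex_of_real (gauss_moment (k t)))"
proof -
  define g where "g i z = complex_of_real (Re z ^ k (i, True) * Im z ^ k (i, False))" for i and z :: complex
  have prod_T: "(\<Prod>t\<in>T. h t) = (\<Prod>i\<in>I. h (i, True) * h (i, False))" for h :: "'i \<times> bool \<Rightarrow> complex"
  proof -
    have "(\<Prod>t\<in>T. h t) = (\<Prod>i\<in>I. \<Prod>b\<in>UNIV. h (i, b))"
      unfolding prod.cartesian_product by (simp add: case_prod_beta')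
    then show ?thesis by (simp add: UNIV_bool mult.commute)
  qed
  have eq: "(\<lambda>\<omega>. \<Prod>t\<in>T. part t \<omega> ^ k t) = (\<lambda>\<omega>. \<Prod>i\<in>I. g i (f i \<omega>))"
    unfolding prod_T by (simp add: part_def g_def)
  have meas: "g i \<in> borel_measurable borel" for i unfolding g_def by measurable
  have indep: "indep_vars (\<lambda>_. borel) (\<lambda>i \<omega>. g i (f i \<omega>)) I"
    by (rule indep_vars_compose2[OF indep_f meas])
  have one: "integrable M (\<lambda>\<omega>. g i (f i \<omega>)) \<and> expectation (\<lambda>\<omega>. g i (f i \<omega>)) =
      complex_of_real (gauss_moment (k (i, True))) * complex_of_real (gauss_moment (k (i, False)))"
    if i: "i \<in> I" for i
  proof -
    have D: "distributed M lborel (\<lambda>\<omega>. Re (f i \<omega>)) (normal_density 0 (sqrt (1/2)))"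
      "distributed M lborel (\<lambda>\<omega>. Im (f i \<omega>)) (normal_density 0 (sqrt (1/2)))"
      "indep_var borel (\<lambda>\<omega>. Re (f i \<omega>)) borel (\<lambda>\<omega>. Im (f i \<omega>))"
      using gauss_f[OF i] unfolding std_complex_gaussian_def by auto
    have iv: "indep_var borel (\<lambda>\<omega>. Re (f i \<omega>) ^ k (i, True)) borel (\<lambda>\<omega>. Im (f i \<omega>) ^ k (i, False))"
      using indep_var_compose[OF D(3), of "\<lambda>x. x ^ k (i, True)" borel "\<lambda>x. x ^ k (i, False)" borel]
      by (simp add: comp_def)
    note m = gauss_moment_expectation[OF D(1)] gauss_moment_expectation[OF D(2)]
    have "integrable M (\<lambda>\<omega>. Re (f i \<omega>) ^ k (i, True) * Im (f i \<omega>) ^ k (i, False))"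
      by (rule indep_var_integrable[OF iv m(1) m(3)])
    moreover have "expectation (\<lambda>\<omega>. Re (f i \<omega>) ^ k (i, True) * Im (f i \<omega>) ^ k (i, False)) =
        gauss_moment (k (i, True)) * gauss_moment (k (i, False))"
      unfolding indep_var_lebesgue_integral[OF iv m(1) m(3)] m(2) m(4) ..
    ultimately show ?thesis unfolding g_def by (simp add: integrable_of_real del: of_real_mult of_real_power) simp
  qed
  show "integrable M (\<lambda>\<omega>. \<Prod>t\<in>T. part t \<omega> ^ k t)"
    unfolding eq by (rule indep_vars_integrable[OF fin indep]) (use one in blast)
  show "expectation (\<lambda>\<omega>. \<Prod>t\<in>T. part t \<omega> ^ k t) = (\<Prod>t\<in>T. complex_of_real (gauss_moment (k t)))"
    unfolding eq unfolding prod_T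
    by (subst indep_vars_lebesgue_integral[OF fin indep]) (use one in auto)
qed

text \<open>Monomials are lists of variables with repetition, so that the product rule becomes a
  recursion over the list.\<close>

definition monom :: "('i \<times> bool) list \<Rightarrow> 'w \<Rightarrow> complex" where
  "monom L \<omega> = prod_list (map (\<lambda>t. part t \<omega>) L)"

lemma monom_simps [simp]: "monom [] \<omega> = 1" "monom (t # L) \<omega> = part t \<omega> * monom L \<omega>"
  by (simp_all add: monom_def)

lemma monom_eq_powers:
  assumes "set L \<subseteq> T"
  shows "monom L \<omega> = (\<Prod>t\<in>T. part t \<omega> ^ count_list L t)"
  using assms
proof (induction L)
  case (Cons s L)
  have finT: "finite T" using fin by simp
  have s: "s \<in> T" using Cons.prems by simp
  have "(\<Prod>t\<in>T. part t \<omega> ^ count_list (s # L) t) =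
      (\<Prod>t\<in>T. (if t = s then part t \<omega> else 1) * part t \<omega> ^ count_list L t)"
    by (rule prod.cong) auto
  also have "\<dots> = (\<Prod>t\<in>T. if t = s then part t \<omega> else 1) * (\<Prod>t\<in>T. part t \<omega> ^ count_list L t)"
    by (rule prod.distrib)
  also have "(\<Prod>t\<in>T. if t = s then part t \<omega> else 1) = part s \<omega>"
    using s finT by (simp add: prod.delta)
  finally show ?case using Cons by simp
qed simp

lemma integrable_monom: "set L \<subseteq> T \<Longrightarrow> integrable M (monom L)"
  using expectation_part_powers(1)[of "count_list L"] monom_eq_powers[of L]
  by (metis (no_types, lifting) ext)

lemma expectation_monom:
  "set L \<subseteq> T \<Longrightarrow> expectation (monom L) = (\<Prod>t\<in>T. complex_of_real (gauss_moment (count_list L t)))"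
  using expectation_part_powers(2)[of "count_list L"] monom_eq_powers[of L]
  by (metis (no_types, lifting) ext)

text \<open>The one-variable recursion acts on the factor belonging to \<open>s\<close> and leaves
  the others alone. If \<open>s\<close> does not occur in \<open>L\<close>, both sides are
  zero.\<close>

lemma expectation_part_monom:
  assumes L: "set L \<subseteq> T" and s: "s \<in> T"
  shows "expectation (monom (s # L)) = of_nat (count_list L s) / 2 * expectation (monom (remove1 s L))"
proof -
  have finT: "finite T" using fin by simp
  have L': "set (remove1 s L) \<subseteq> T" using L set_remove1_subset by fastforce
  have c1: "count_list (remove1 s L) s = count_list L s - 1"
    by (induction L) auto
  have c2: "count_list (remove1 s L) t = count_list L t" if "t \<noteq> s" for t
    using that by (induction L) auto
  let ?g = "\<lambda>k. complex_of_real (gauss_moment k)"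
  let ?R = "\<Prod>t\<in>T - {s}. ?g (count_list L t)"
  have "expectation (monom (s # L)) = (\<Prod>t\<in>T. ?g (count_list (s # L) t))"
    by (rule expectation_monom) (use L s in auto)
  also have "\<dots> = ?g (count_list (s # L) s) * (\<Prod>t\<in>T - {s}. ?g (count_list (s # L) t))"
    by (rule prod.remove[OF finT s])
  also have "(\<Prod>t\<in>T - {s}. ?g (count_list (s # L) t)) = ?R" by (rule prod.cong) auto
  also have "count_list (s # L) s = Suc (count_list L s)" by simp
  also have "?g (Suc (count_list L s)) = of_nat (count_list L s) / 2 * ?g (count_list L s - 1)"
    by (simp add: gauss_moment_Suc)
  finally have "expectation (monom (s # L)) = of_nat (count_list L s) / 2 * (?g (count_list L s - 1) * ?R)"
    by (simp only: mult.assoc)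
  moreover have "expectation (monom (remove1 s L)) = ?g (count_list L s - 1) * ?R"
  proof -
    have "(\<Prod>t\<in>T - {s}. ?g (count_list (remove1 s L) t)) = ?R"
      by (rule prod.cong) (use c2 in auto)
    then show ?thesis
      unfolding expectation_monom[OF L'] prod.remove[OF finT s] c1 by simp
  qed
  ultimately show ?thesis by simp
qed

text \<open>The product rule for the derivative in direction \<open>v\<close>, each differentiated
  variable carrying the variance 1/2.\<close>

fun dmonom :: "('i \<times> bool \<Rightarrow> complex) \<Rightarrow> ('i \<times> bool) list \<Rightarrow> 'w \<Rightarrow> complex" where
  "dmonom v [] \<omega> = 0"
| "dmonom v (t # L) \<omega> = v t / 2 * monom L \<omega> + part t \<omega> * dmonom v L \<omega>"

text \<open>Collects equal terms of the product rule, one per variable with its multiplicity; this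
  is the shape produced by \<open>expectation_part_monom\<close>.\<close>

lemma dmonom_eq:
  assumes "set L \<subseteq> T"
  shows "dmonom v L \<omega> = (\<Sum>s\<in>T. v s / 2 * of_nat (count_list L s) * monom (remove1 s L) \<omega>)"
  using assms
proof (induction L)
  case (Cons t L)
  have finT: "finite T" using fin by simp
  have t: "t \<in> T" using Cons.prems by simp
  have part_remove: "part s \<omega> * monom (remove1 s K) \<omega> = monom K \<omega>" if "s \<in> set K" for s K
    using that by (induction K) (auto simp: mult.left_commute)
  have "(\<Sum>s\<in>T. v s / 2 * of_nat (count_list (t # L) s) * monom (remove1 s (t # L)) \<omega>) =
    (\<Sum>s\<in>T. (if s = t then v t / 2 * monom L \<omega> else 0) +
      part t \<omega> * (v s / 2 * of_nat (count_list L s) * monom (remove1 s L) \<omega>))"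
  proof (rule sum.cong[OF refl])
    fix s
    show "v s / 2 * of_nat (count_list (t # L) s) * monom (remove1 s (t # L)) \<omega> =
      (if s = t then v t / 2 * monom L \<omega> else 0) +
      part t \<omega> * (v s / 2 * of_nat (count_list L s) * monom (remove1 s L) \<omega>)"
    proof (cases "s = t")
      case True
      \<comment> \<open>If \<open>t\<close> is not in \<open>L\<close>, then \<open>remove1\<close>
        changes nothing, but the multiplicity is zero.\<close>
      have "of_nat (count_list L t) * (part t \<omega> * monom (remove1 t L) \<omega>) =
          of_nat (count_list L t) * monom L \<omega>"
        using part_remove[of t L] by (cases "t \<in> set L") (simp_all add: count_notin)
      then have e: "part t \<omega> * (v t / 2 * of_nat (count_list L t) * monom (remove1 t L) \<omega>) =
          v t / 2 * (of_nat (count_list L t) * monom L \<omega>)"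
        by (metis mult.assoc mult.left_commute)
      have "v t / 2 * of_nat (count_list (t # L) t) * monom (remove1 t (t # L)) \<omega> =
          v t / 2 * monom L \<omega> + v t / 2 * (of_nat (count_list L t) * monom L \<omega>)"
        by (simp add: algebra_simps)
      then show ?thesis unfolding True e by (simp only: if_True refl)
    qed (simp add: algebra_simps)
  qed
  also have "\<dots> = v t / 2 * monom L \<omega> + part t \<omega> * dmonom v L \<omega>"
    unfolding sum.distrib sum_distrib_left[symmetric] using finT t Cons by (simp add: sum.delta)
  finally show ?case by simp
qed simp

text \<open>\<open>deriv_pair v F F'\<close>: \<open>F\<close> is a polynomial in the Gaussian variables and \<open>F'\<close> is half its
  derivative in direction \<open>v\<close>; the factor one half is the variance.\<close>

inductive deriv_pair :: "('i \<times> bool \<Rightarrow> complex) \<Rightarrow> ('w \<Rightarrow> complex) \<Rightarrow> ('w \<Rightarrow> complex) \<Rightarrow> bool" for v where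
  monom: "set L \<subseteq> T \<Longrightarrow> deriv_pair v (monom L) (dmonom v L)"
| add: "deriv_pair v F F' \<Longrightarrow> deriv_pair v G G' \<Longrightarrow> deriv_pair v (\<lambda>\<omega>. F \<omega> + G \<omega>) (\<lambda>\<omega>. F' \<omega> + G' \<omega>)"
| scale: "deriv_pair v F F' \<Longrightarrow> deriv_pair v (\<lambda>\<omega>. c * F \<omega>) (\<lambda>\<omega>. c * F' \<omega>)"

lemma deriv_pair_cong:
  "deriv_pair v F F' \<Longrightarrow> (\<And>\<omega>. F \<omega> = G \<omega>) \<Longrightarrow> (\<And>\<omega>. F' \<omega> = G' \<omega>) \<Longrightarrow> deriv_pair v G G'"
  by (metis ext)

lemma deriv_pair_const: "deriv_pair v (\<lambda>\<omega>. c) (\<lambda>\<omega>. 0)"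
  by (rule deriv_pair_cong[OF deriv_pair.scale[OF deriv_pair.monom[of "[]" v], of c]]) auto

lemma deriv_pair_part: "t \<in> T \<Longrightarrow> deriv_pair v (part t) (\<lambda>\<omega>. v t / 2)"
  by (rule deriv_pair_cong[OF deriv_pair.monom[of "[t]" v]]) auto

lemma deriv_pair_sum:
  assumes "\<And>a. a \<in> A \<Longrightarrow> deriv_pair v (F a) (F' a)"
  shows "deriv_pair v (\<lambda>\<omega>. \<Sum>a\<in>A. F a \<omega>) (\<lambda>\<omega>. \<Sum>a\<in>A. F' a \<omega>)"
  using assms
  by (induction A rule: infinite_finite_induct) (auto intro: deriv_pair_const deriv_pair.add)

lemma deriv_pair_part_mult:
  assumes "deriv_pair v F F'" "t \<in> T"
  shows "deriv_pair v (\<lambda>\<omega>. part t \<omega> * F \<omega>) (\<lambda>\<omega>. v t / 2 * F \<omega> + part t \<omega> * F' \<omega>)"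
  using assms(1)
proof induction
  case (monom L)
  show ?case
    by (rule deriv_pair_cong[OF deriv_pair.monom[of "t # L" v]]) (use monom assms in auto)
next
  case (add F F' G G')
  show ?case
    by (rule deriv_pair_cong[OF deriv_pair.add[OF add.IH]]) (auto simp: algebra_simps)
next
  case (scale F F' c)
  show ?case
    by (rule deriv_pair_cong[OF deriv_pair.scale[OF scale.IH, of c]]) (auto simp: algebra_simps)
qed

text \<open>Products are not among the generating rules; induction over the first factor reduces
  them to multiplication by one variable at a time.\<close>

lemma deriv_pair_mult:
  assumes F: "deriv_pair v F F'" and G: "deriv_pair v G G'"
  shows "deriv_pair v (\<lambda>\<omega>. F \<omega> * G \<omega>) (\<lambda>\<omega>. F' \<omega> * G \<omega> + F \<omega> * G' \<omega>)"
  using F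
proof induction
  case (monom L)
  then show ?case
  proof (induction L)
    case Nil
    show ?case by (rule deriv_pair_cong[OF G]) auto
  next
    case (Cons t L)
    then have *: "deriv_pair v (\<lambda>\<omega>. monom L \<omega> * G \<omega>) (\<lambda>\<omega>. dmonom v L \<omega> * G \<omega> + monom L \<omega> * G' \<omega>)"
      by simp
    show ?case
      by (rule deriv_pair_cong[OF deriv_pair_part_mult[OF *, of t]])
        (use Cons.prems in \<open>auto simp: algebra_simps\<close>)
  qed
next
  case (add F F' H H')
  show ?case
    by (rule deriv_pair_cong[OF deriv_pair.add[OF add.IH]]) (auto simp: algebra_simps)
next
  case (scale F F' c)
  show ?case
    by (rule deriv_pair_cong[OF deriv_pair.scale[OF scale.IH, of c]]) (auto simp: algebra_simps)
qed

text \<open>The Gaussian factor that is integrated by parts; its coefficient vector \<open>v\<close>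
  is also the direction of differentiation, without conjugation.\<close>

definition linear_form :: "('i \<times> bool \<Rightarrow> complex) \<Rightarrow> 'w \<Rightarrow> complex" where
  "linear_form v \<omega> = (\<Sum>t\<in>T. v t * part t \<omega>)"

lemma integrable_dmonom: "set L \<subseteq> T \<Longrightarrow> integrable M (dmonom v L)"
proof -
  assume L: "set L \<subseteq> T"
  have eq: "dmonom v L = (\<lambda>\<omega>. \<Sum>s\<in>T. v s / 2 * of_nat (count_list L s) * monom (remove1 s L) \<omega>)"
    using dmonom_eq[OF L] by blast
  have "set (remove1 s L) \<subseteq> T" for s using L set_remove1_subset by fastforce
  then show ?thesis unfolding eq
    by (intro Bochner_Integration.integrable_sum integrable_mult_right integrable_monom)
qed

text \<open>By linearity only monomials matter, where each summand of the linear form is handled by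
  \<open>expectation_part_monom\<close>. Integrability is carried through the induction because
  additivity of the integral depends on it.\<close>

lemma gaussian_by_parts:
  assumes "deriv_pair v F F'"
  shows "integrable M F" "integrable M F'" "integrable M (\<lambda>\<omega>. linear_form v \<omega> * F \<omega>)"
    "expectation (\<lambda>\<omega>. linear_form v \<omega> * F \<omega>) = expectation F'"
proof -
  have "integrable M F \<and> integrable M F' \<and> integrable M (\<lambda>\<omega>. linear_form v \<omega> * F \<omega>) \<and>
    expectation (\<lambda>\<omega>. linear_form v \<omega> * F \<omega>) = expectation F'"
    using assms
  proof induction
    case (monom L)
    have eq: "(\<lambda>\<omega>. linear_form v \<omega> * monom L \<omega>) = (\<lambda>\<omega>. \<Sum>t\<in>T. v t * monom (t # L) \<omega>)"
      by (simp add: linear_form_def sum_distrib_right mult.assoc)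
    have int: "integrable M (monom (t # L))" if "t \<in> T" for t
      using monom that by (intro integrable_monom) auto
    have L': "set (remove1 s L) \<subseteq> T" for s using monom set_remove1_subset by fastforce
    have "expectation (\<lambda>\<omega>. linear_form v \<omega> * monom L \<omega>) = (\<Sum>t\<in>T. v t * expectation (monom (t # L)))"
      unfolding eq
      by (subst Bochner_Integration.integral_sum)
        (intro integrable_mult_right int, assumption, simp only: integral_mult_right_zero)
    also have "\<dots> = (\<Sum>t\<in>T. v t / 2 * of_nat (count_list L t) * expectation (monom (remove1 t L)))"
      using monom by (intro sum.cong refl) (simp add: expectation_part_monom del: monom_simps)
    also have "\<dots> = expectation (\<lambda>\<omega>. \<Sum>s\<in>T. v s / 2 * of_nat (count_list L s) * monom (remove1 s L) \<omega>)"
      by (subst Bochner_Integration.integral_sum)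
        (intro integrable_mult_right integrable_monom[OF L'], simp only: integral_mult_right_zero)
    also have "\<dots> = expectation (dmonom v L)"
      by (rule arg_cong[where f = expectation], rule ext, rule dmonom_eq[OF monom, symmetric])
    moreover have "integrable M (\<lambda>\<omega>. linear_form v \<omega> * monom L \<omega>)"
      unfolding eq by (intro Bochner_Integration.integrable_sum integrable_mult_right int)
    ultimately show ?case using integrable_monom[OF monom] integrable_dmonom[OF monom] by simp
  next
    case (add F F' G G')
    then show ?case by (simp add: distrib_left)
  next
    case (scale F F' c)
    then show ?case by (simp add: mult.left_commute[of _ c])
  qed
  then show "integrable M F" "integrable M F'" "integrable M (\<lambda>\<omega>. linear_form v \<omega> * F \<omega>)"
    "expectation (\<lambda>\<omega>. linear_form v \<omega> * F \<omega>) = expectation F'" by auto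
qed

end

section \<open>Loop equations for words in a GUE matrix and a permutation\<close>

text \<open>\<open>LH\<close> stands for the self-adjoint matrix with entries \<open>h i j\<close>, \<open>LU\<close> for the permutation matrix whose
  non-zero entries are those at \<open>(p j, j)\<close>, \<open>LUi\<close> for its inverse; multiplying by \<open>LU\<close> on the left
  therefore moves the row index by the inverse of \<open>p\<close>.\<close>

datatype letter = LH | LU | LUi

fun entry :: "nat \<Rightarrow> (nat \<Rightarrow> nat) \<Rightarrow> (nat \<Rightarrow> nat \<Rightarrow> complex) \<Rightarrow> letter list \<Rightarrow> nat \<Rightarrow> nat \<Rightarrow> complex" where
  "entry N p h [] i j = (if i = j then 1 else 0)"
| "entry N p h (LH # w) i j = (\<Sum>k<N. h i k * entry N p h w k j)"
| "entry N p h (LU # w) i j = entry N p h w (inv_into UNIV p i) j"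
| "entry N p h (LUi # w) i j = entry N p h w (p i) j"

definition word_trace :: "nat \<Rightarrow> (nat \<Rightarrow> nat) \<Rightarrow> (nat \<Rightarrow> nat \<Rightarrow> complex) \<Rightarrow> letter list \<Rightarrow> complex" where
  "word_trace N p h w = (\<Sum>i<N. entry N p h w i i) / of_nat N"

lemma permutes_less:
  assumes "p permutes {..<N}" "i < N"
  shows "p i < N" "inv_into UNIV p i < N"
  using permutes_in_image[OF assms(1), of i] permutes_in_image[OF permutes_inv[OF assms(1)], of i] assms(2)
  by simp_all

lemma entry_append:
  assumes p: "p permutes {..<N}" and "i < N"
  shows "entry N p h (u @ v) i j = (\<Sum>k<N. entry N p h u i k * entry N p h v k j)"
  using \<open>i < N\<close>
proof (induction u arbitrary: i)
  case Nil
  have "(\<Sum>k<N. entry N p h [] i k * entry N p h v k j) = (\<Sum>k<N. if i = k then entry N p h v k j else 0)"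
    by (rule sum.cong) auto
  then show ?case using Nil by simp
next
  case (Cons l u)
  show ?case
  proof (cases l)
    case LH
    have "entry N p h ((l # u) @ v) i j = (\<Sum>k<N. \<Sum>m<N. h i k * (entry N p h u k m * entry N p h v m j))"
      using LH Cons.IH by (simp add: sum_distrib_left)
    also have "\<dots> = (\<Sum>m<N. \<Sum>k<N. h i k * (entry N p h u k m * entry N p h v m j))"
      by (rule sum.swap)
    finally show ?thesis using LH by (simp add: sum_distrib_right mult.assoc)
  next
    case LU
    then show ?thesis using Cons.IH[OF permutes_less(2)[OF p Cons.prems]] by simp
  next
    case LUi
    then show ?thesis using Cons.IH[OF permutes_less(1)[OF p Cons.prems]] by simp
  qed
qed

lemma word_trace_cyclic:
  assumes p: "p permutes {..<N}"
  shows "word_trace N p h (u @ v) = word_trace N p h (v @ u)"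
proof -
  have "(\<Sum>i<N. entry N p h (u @ v) i i) = (\<Sum>i<N. \<Sum>k<N. entry N p h u i k * entry N p h v k i)"
    using entry_append[OF p] by (intro sum.cong refl) auto
  also have "\<dots> = (\<Sum>k<N. \<Sum>i<N. entry N p h v k i * entry N p h u i k)"
    by (subst sum.swap) (simp add: mult.commute)
  also have "\<dots> = (\<Sum>k<N. entry N p h (v @ u) k k)"
    using entry_append[OF p] by (intro sum.cong refl) auto
  finally show ?thesis by (simp add: word_trace_def)
qed

text \<open>Its role is in the limit: the recursion defining the limits does not show this
  invariance, but inherits it from finite \<open>N\<close>.\<close>

lemma word_trace_conj_cancel:
  assumes p: "p permutes {..<N}"
  shows "word_trace N p h (LUi # w @ [LU]) = word_trace N p h w"
proof -
  have "word_trace N p h (LUi # w @ [LU]) = word_trace N p h ((w @ [LU]) @ [LUi])"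
    using word_trace_cyclic[OF p, of h "[LUi]" "w @ [LU]"] by simp
  also have "\<dots> = word_trace N p h ([LU, LUi] @ w)"
    using word_trace_cyclic[OF p, of h w "[LU, LUi]"] by simp
  also have "\<dots> = word_trace N p h w"
    using permutes_inverses[OF p] by (simp add: word_trace_def)
  finally show ?thesis .
qed

text \<open>One cut for each factor of the word that the product rule can differentiate; the letter
  \<open>LH\<close> at the cut disappears.\<close>

fun splits :: "letter list \<Rightarrow> (letter list \<times> letter list) list" where
  "splits [] = []"
| "splits (l # w) = (if l = LH then [([], w)] else []) @ map (\<lambda>(u, v). (l # u, v)) (splits w)"

lemma set_splits: "set (splits w) = {(u, v). w = u @ LH # v}"
proof (induction w)
  case (Cons l w)
  show ?case
  proof (rule Set.set_eqI)
    fix x :: "letter list \<times> letter list"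
    obtain u v where x: "x = (u, v)" by (cases x)
    show "x \<in> set (splits (l # w)) \<longleftrightarrow> x \<in> {(u, v). l # w = u @ LH # v}"
      using Cons x by (cases u) auto
  qed
qed simp

text \<open>A list and not a set: equal words at different positions must be counted separately in
  the product rule.\<close>

fun picks :: "'a list \<Rightarrow> ('a \<times> 'a list) list" where
  "picks [] = []"
| "picks (x # xs) = (x, xs) # map (\<lambda>(y, r). (y, x # r)) (picks xs)"

lemma set_picks: "(y, r) \<in> set (picks xs) \<Longrightarrow> \<exists>as bs. xs = as @ y # bs \<and> r = as @ bs"
proof (induction xs arbitrary: r)
  case (Cons x xs)
  show ?case
  proof (cases "(y, r) = (x, xs)")
    case True
    then show ?thesis by (intro exI[of _ "[]"] exI[of _ xs]) auto
  next
    case False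
    then obtain r' where r: "(y, r') \<in> set (picks xs)" "r = x # r'" using Cons.prems by auto
    obtain as bs where "xs = as @ y # bs" "r' = as @ bs" using Cons.IH[OF r(1)] by blast
    then show ?thesis using r by (intro exI[of _ "x # as"] exI[of _ bs]) auto
  qed
qed simp

text \<open>The square of the imaginary unit in the second product cancels \<open>A * C\<close> and
  \<open>B * D\<close>, leaving only the mixed terms; these encode that an entry is correlated only
  with its transposed entry.\<close>

lemma gue_dir_identity:
  "((A + B) / k) * ((C + D) / k / 2) + (\<i> * (A - B) / k) * (\<i> * (C - D) / k / 2) =
    (A * D + B * C) / (k * k)" for A B C D k :: complex
  by (cases "k = 0") (simp_all add: field_simps)

lemma if_signed_i:
  "(if P then \<i> else 0) + (if Q then - \<i> else 0) = \<i> * ((if P then 1 else 0) - (if Q then 1 else 0))"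
  by simp

lemma sum_sum_list_swap:
  "(\<Sum>k\<in>A. \<Sum>x\<leftarrow>L. g k x) = (\<Sum>x\<leftarrow>L. \<Sum>k\<in>A. (g k x :: 'b :: comm_monoid_add))"
  by (induction L) (simp_all add: sum.distrib)

section \<open>GUE entries as linear forms in the Gaussian variables, and their covariance\<close>

locale gue_model = gaussian_entries M "{..<N} \<times> {..<N}" "\<lambda>(i, j). f i j"
  for M :: "'w measure" and N :: nat and f :: "nat \<Rightarrow> nat \<Rightarrow> 'w \<Rightarrow> complex" +
  assumes N_pos: "N > 0"
begin

definition gue :: "'w \<Rightarrow> nat \<Rightarrow> nat \<Rightarrow> complex" where
  "gue \<omega> i j = (cnj (f j i \<omega>) + f i j \<omega>) / complex_of_real (sqrt (2 * real N))"

text \<open>Coefficients of the entry \<open>(a, b)\<close>: the first summand comes from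
  \<open>f a b\<close>, the second from the conjugate of \<open>f b a\<close>. On the diagonal both
  apply, and the imaginary coefficients cancel. The root of \<open>2 * N\<close> combines the
  normalizations of the Gaussian matrix and of its symmetrization.\<close>

definition gue_dir :: "nat \<Rightarrow> nat \<Rightarrow> (nat \<times> nat) \<times> bool \<Rightarrow> complex" where
  "gue_dir a b t = ((if fst t = (a, b) then (if snd t then 1 else \<i>) else 0) +
    (if fst t = (b, a) then (if snd t then 1 else - \<i>) else 0)) / complex_of_real (sqrt (2 * real N))"

lemma sum_T: "(\<Sum>t\<in>T. g t) = (\<Sum>x\<in>{..<N} \<times> {..<N}. g (x, True) + g (x, False))"
  for g :: "(nat \<times> nat) \<times> bool \<Rightarrow> complex"
proof -
  have "(\<Sum>t\<in>T. g t) = (\<Sum>x\<in>{..<N} \<times> {..<N}. \<Sum>b\<in>UNIV. g (x, b))"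
    unfolding sum.cartesian_product by (simp add: case_prod_beta')
  then show ?thesis by (simp add: UNIV_bool add.commute)
qed

lemma linear_form_gue_dir:
  assumes "a < N" "b < N"
  shows "linear_form (gue_dir a b) \<omega> = gue \<omega> a b"
proof -
  let ?k = "complex_of_real (sqrt (2 * real N))"
  have pt: "gue_dir a b (x, True) * part (x, True) \<omega> + gue_dir a b (x, False) * part (x, False) \<omega> =
      (if x = (a, b) then f a b \<omega> / ?k else 0) + (if x = (b, a) then cnj (f b a \<omega>) / ?k else 0)" for x
  proof -
    define A B :: complex where "A = (if x = (a, b) then 1 else 0)" and "B = (if x = (b, a) then 1 else 0)"
    define z where "z = f (fst x) (snd x) \<omega>"
    have z: "complex_of_real (Re z) + \<i> * complex_of_real (Im z) = z"
      "complex_of_real (Re z) - \<i> * complex_of_real (Im z) = cnj z"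
      by (simp_all add: complex_eq_iff)
    have d: "gue_dir a b (x, True) = (A + B) / ?k" "gue_dir a b (x, False) = \<i> * (A - B) / ?k"
      "part (x, True) \<omega> = complex_of_real (Re z)" "part (x, False) \<omega> = complex_of_real (Im z)"
      by (simp_all only: gue_dir_def fst_conv snd_conv if_True if_False A_def B_def part_def z_def
          split_beta if_signed_i)
    have "gue_dir a b (x, True) * part (x, True) \<omega> + gue_dir a b (x, False) * part (x, False) \<omega> =
        A * ((complex_of_real (Re z) + \<i> * complex_of_real (Im z)) / ?k) +
        B * ((complex_of_real (Re z) - \<i> * complex_of_real (Im z)) / ?k)"
      unfolding d divide_inverse by (simp only: algebra_simps)
    also have "\<dots> = (if x = (a, b) then f a b \<omega> / ?k else 0) + (if x = (b, a) then cnj (f b a \<omega>) / ?k else 0)"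
    proof -
      have "A * (z / ?k) = (if x = (a, b) then f a b \<omega> / ?k else 0)"
        by (simp add: A_def z_def)
      moreover have "B * (cnj z / ?k) = (if x = (b, a) then cnj (f b a \<omega>) / ?k else 0)"
        by (simp add: B_def z_def)
      ultimately show ?thesis by (simp only: z)
    qed
    finally show ?thesis .
  qed
  have "linear_form (gue_dir a b) \<omega> = (\<Sum>x\<in>{..<N} \<times> {..<N}.
      gue_dir a b (x, True) * part (x, True) \<omega> + gue_dir a b (x, False) * part (x, False) \<omega>)"
    unfolding linear_form_def by (rule sum_T)
  also have "\<dots> = (\<Sum>x\<in>{..<N} \<times> {..<N}.
      (if x = (a, b) then f a b \<omega> / ?k else 0) + (if x = (b, a) then cnj (f b a \<omega>) / ?k else 0))"
    by (simp only: pt)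
  also have "\<dots> = gue \<omega> a b"
    using assms by (simp add: sum.distrib gue_def add_divide_distrib add.commute)
  finally show ?thesis .
qed

text \<open>The covariance of two GUE entries. The positions \<open>(i, j)\<close> and
  \<open>(j, i)\<close> contribute \<open>1 / (2 * N)\<close> each, also when they coincide.\<close>

lemma sum_gue_dir:
  assumes "a < N" "b < N" "i < N" "j < N"
  shows "(\<Sum>t\<in>T. gue_dir i j t * (gue_dir a b t / 2)) = (if i = b \<and> j = a then 1 / of_nat N else 0)"
proof -
  let ?k = "complex_of_real (sqrt (2 * real N))"
  have k: "?k * ?k = 2 * of_nat N"
  proof -
    have "?k * ?k = complex_of_real (sqrt (2 * real N) * sqrt (2 * real N))" by (simp only: of_real_mult)
    then show ?thesis by simp
  qed
  have pt: "gue_dir i j (x, True) * (gue_dir a b (x, True) / 2) + gue_dir i j (x, False) * (gue_dir a b (x, False) / 2)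
      = (if x = (i, j) then (if (i, j) = (b, a) then 1 / (2 * of_nat N) else 0) else 0) +
      (if x = (j, i) then (if (j, i) = (a, b) then 1 / (2 * of_nat N) else 0) else 0)" for x
  proof -
    define A B C D :: complex where "A = (if x = (i, j) then 1 else 0)" and "B = (if x = (j, i) then 1 else 0)"
      and "C = (if x = (a, b) then 1 else 0)" and "D = (if x = (b, a) then 1 else 0)"
    have d: "gue_dir i j (x, True) = (A + B) / ?k" "gue_dir i j (x, False) = \<i> * (A - B) / ?k"
      "gue_dir a b (x, True) = (C + D) / ?k" "gue_dir a b (x, False) = \<i> * (C - D) / ?k"
      by (simp_all only: gue_dir_def fst_conv snd_conv if_True if_False A_def B_def C_def D_def if_signed_i)
    have "gue_dir i j (x, True) * (gue_dir a b (x, True) / 2) + gue_dir i j (x, False) * (gue_dir a b (x, False) / 2)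
      = (A * D + B * C) / (?k * ?k)"
      unfolding d by (rule gue_dir_identity)
    also have "\<dots> = (A * D + B * C) / (2 * of_nat N)"
      unfolding k ..
    also have "\<dots> = (if x = (i, j) then (if (i, j) = (b, a) then 1 / (2 * of_nat N) else 0) else 0) +
      (if x = (j, i) then (if (j, i) = (a, b) then 1 / (2 * of_nat N) else 0) else 0)"
    proof -
      have "A * D / (2 * of_nat N) = (if x = (i, j) then (if (i, j) = (b, a) then 1 / (2 * of_nat N) else 0) else 0)"
        by (simp add: A_def D_def)
      moreover have "B * C / (2 * of_nat N) = (if x = (j, i) then (if (j, i) = (a, b) then 1 / (2 * of_nat N) else 0) else 0)"
        by (simp add: B_def C_def)
      ultimately show ?thesis by (simp only: add_divide_distrib)
    qed
    finally show ?thesis .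
  qed
  have "(\<Sum>t\<in>T. gue_dir i j t * (gue_dir a b t / 2)) = (\<Sum>x\<in>{..<N} \<times> {..<N}.
      gue_dir i j (x, True) * (gue_dir a b (x, True) / 2) + gue_dir i j (x, False) * (gue_dir a b (x, False) / 2))"
    by (rule sum_T)
  also have "\<dots> = (\<Sum>x\<in>{..<N} \<times> {..<N}.
      (if x = (i, j) then (if (i, j) = (b, a) then 1 / (2 * of_nat N) else 0) else 0) +
      (if x = (j, i) then (if (j, i) = (a, b) then 1 / (2 * of_nat N) else 0) else 0))"
    by (simp only: pt)
  also have "\<dots> = (if i = b \<and> j = a then 1 / of_nat N else 0)"
    using assms by (simp add: sum.distrib)
  finally show ?thesis .
qed

lemma deriv_pair_gue:
  assumes "a < N" "b < N" "i < N" "j < N"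
  shows "deriv_pair (gue_dir a b) (\<lambda>\<omega>. gue \<omega> i j) (\<lambda>\<omega>. if i = b \<and> j = a then 1 / of_nat N else 0)"
proof -
  have "deriv_pair (gue_dir a b) (\<lambda>\<omega>. \<Sum>t\<in>T. gue_dir i j t * part t \<omega>)
      (\<lambda>\<omega>. \<Sum>t\<in>T. gue_dir i j t * (gue_dir a b t / 2))"
    by (intro deriv_pair_sum deriv_pair.scale deriv_pair_part)
  then show ?thesis
    by (rule deriv_pair_cong)
      (use assms linear_form_gue_dir sum_gue_dir in \<open>auto simp: linear_form_def\<close>)
qed

section \<open>Derivatives of words and traces, and the loop equation for a fixed
  permutation\<close>

abbreviation "ent p \<omega> \<equiv> entry N p (gue \<omega>)"
abbreviation "trw p \<omega> \<equiv> word_trace N p (gue \<omega>)"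
abbreviation "trs p \<omega> ws \<equiv> (\<Prod>w\<leftarrow>ws. word_trace N p (gue \<omega>) w)"

text \<open>By the covariance, differentiation replaces one \<open>LH\<close> by the matrix unit at
  \<open>(b, a)\<close> divided by \<open>N\<close>, so the path from \<open>i\<close> to
  \<open>j\<close> breaks there into a path to \<open>b\<close> and a path from
  \<open>a\<close>.\<close>

lemma deriv_pair_entry:
  assumes p: "p permutes {..<N}" and ab: "a < N" "b < N" and "i < N"
  shows "deriv_pair (gue_dir a b) (\<lambda>\<omega>. ent p \<omega> w i j)
    (\<lambda>\<omega>. \<Sum>(u, v)\<leftarrow>splits w. ent p \<omega> u i b * ent p \<omega> v a j / of_nat N)"
  using \<open>i < N\<close>
proof (induction w arbitrary: i)
  case Nil
  show ?case by (rule deriv_pair_cong[OF deriv_pair_const]) auto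
next
  case (Cons l w)
  show ?case
  proof (cases l)
    case LH
    have "deriv_pair (gue_dir a b) (\<lambda>\<omega>. \<Sum>k<N. gue \<omega> i k * ent p \<omega> w k j)
      (\<lambda>\<omega>. \<Sum>k<N. (if i = b \<and> k = a then 1 / of_nat N else 0) * ent p \<omega> w k j +
        gue \<omega> i k * (\<Sum>(u, v)\<leftarrow>splits w. ent p \<omega> u k b * ent p \<omega> v a j / of_nat N))"
      using Cons ab by (intro deriv_pair_sum deriv_pair_mult deriv_pair_gue) auto
    then show ?thesis
    proof (rule deriv_pair_cong)
      fix \<omega>
      have "(\<Sum>k<N. (if i = b \<and> k = a then 1 / of_nat N else 0) * ent p \<omega> w k j) =
          (if i = b then ent p \<omega> w a j / of_nat N else 0)"
      proof -
        have "(\<Sum>k<N. (if i = b \<and> k = a then 1 / of_nat N else 0) * ent p \<omega> w k j) =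
          (\<Sum>k<N. if k = a then (if i = b then ent p \<omega> w a j / of_nat N else 0) else 0)"
          by (rule sum.cong) auto
        then show ?thesis using ab by simp
      qed
      moreover have "(\<Sum>k<N. gue \<omega> i k * (\<Sum>(u, v)\<leftarrow>splits w. ent p \<omega> u k b * ent p \<omega> v a j / of_nat N)) =
          (\<Sum>(u, v)\<leftarrow>splits w. ent p \<omega> (LH # u) i b * ent p \<omega> v a j / of_nat N)"
        unfolding sum_list_const_mult[symmetric] sum_sum_list_swap
        by (simp add: case_prod_beta' sum_divide_distrib sum_distrib_right mult.assoc)
      ultimately show "(\<Sum>k<N. (if i = b \<and> k = a then 1 / of_nat N else 0) * ent p \<omega> w k j +
        gue \<omega> i k * (\<Sum>(u, v)\<leftarrow>splits w. ent p \<omega> u k b * ent p \<omega> v a j / of_nat N)) =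
        (\<Sum>(u, v)\<leftarrow>splits (l # w). ent p \<omega> u i b * ent p \<omega> v a j / of_nat N)"
        unfolding LH sum.distrib by (simp add: comp_def case_prod_beta')
    qed (simp add: LH)
  next
    case LU
    show ?thesis
      by (rule deriv_pair_cong[OF Cons.IH[OF permutes_less(2)[OF p Cons.prems]]])
        (simp_all add: LU comp_def case_prod_beta')
  next
    case LUi
    show ?thesis
      by (rule deriv_pair_cong[OF Cons.IH[OF permutes_less(1)[OF p Cons.prems]]])
        (simp_all add: LUi comp_def case_prod_beta')
  qed
qed

text \<open>Summing over the closing index glues the end of \<open>v\<close> to the start of
  \<open>u\<close>. One factor \<open>1 / N\<close> comes from the covariance, the other from the
  normalization of the trace.\<close>

lemma deriv_pair_word_trace:
  assumes p: "p permutes {..<N}" and ab: "a < N" "b < N"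
  shows "deriv_pair (gue_dir a b) (\<lambda>\<omega>. trw p \<omega> w)
    (\<lambda>\<omega>. \<Sum>(u, v)\<leftarrow>splits w. ent p \<omega> (v @ u) a b / (of_nat N)\<^sup>2)"
proof -
  have "deriv_pair (gue_dir a b) (\<lambda>\<omega>. 1 / of_nat N * (\<Sum>i<N. ent p \<omega> w i i))
    (\<lambda>\<omega>. 1 / of_nat N * (\<Sum>i<N. \<Sum>(u, v)\<leftarrow>splits w. ent p \<omega> u i b * ent p \<omega> v a i / of_nat N))"
    by (intro deriv_pair.scale deriv_pair_sum deriv_pair_entry p ab) auto
  then show ?thesis
  proof (rule deriv_pair_cong)
    fix \<omega>
    have "1 / of_nat N * (\<Sum>i<N. ent p \<omega> u i b * ent p \<omega> v a i / of_nat N) = ent p \<omega> (v @ u) a b / (of_nat N)\<^sup>2" for u v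
      unfolding entry_append[OF p ab(1)]
      by (simp add: sum_divide_distrib sum_distrib_left power2_eq_square mult.commute)
    then show "1 / of_nat N * (\<Sum>i<N. \<Sum>(u, v)\<leftarrow>splits w. ent p \<omega> u i b * ent p \<omega> v a i / of_nat N) =
      (\<Sum>(u, v)\<leftarrow>splits w. ent p \<omega> (v @ u) a b / (of_nat N)\<^sup>2)"
      unfolding sum_sum_list_swap sum_list_const_mult[symmetric] by (simp add: case_prod_beta')
  qed (simp add: word_trace_def)
qed

lemma deriv_pair_word_traces:
  assumes p: "p permutes {..<N}" and ab: "a < N" "b < N"
  shows "deriv_pair (gue_dir a b) (\<lambda>\<omega>. trs p \<omega> ws)
    (\<lambda>\<omega>. \<Sum>(w, r)\<leftarrow>picks ws. (\<Sum>(u, v)\<leftarrow>splits w. ent p \<omega> (v @ u) a b / (of_nat N)\<^sup>2) * trs p \<omega> r)"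
proof (induction ws)
  case Nil
  show ?case by (rule deriv_pair_cong[OF deriv_pair_const]) auto
next
  case (Cons w ws)
  show ?case
    by (rule deriv_pair_cong[OF deriv_pair_mult[OF deriv_pair_word_trace[OF p ab, of w] Cons]])
      (simp_all add: comp_def case_prod_beta' sum_list_const_mult[symmetric] mult.left_commute)
qed

text \<open>Only polynomiality matters here; \<open>N_pos\<close> supplies the valid direction
  \<open>(0, 0)\<close>.\<close>

lemma integrable_word_traces: "p permutes {..<N} \<Longrightarrow> integrable M (\<lambda>\<omega>. trs p \<omega> ws)"
  by (rule gaussian_by_parts(1)[OF deriv_pair_word_traces[OF _ N_pos N_pos]])

definition mixed_moment :: "(nat \<Rightarrow> nat) \<Rightarrow> letter list list \<Rightarrow> complex" where
  "mixed_moment p ws = expectation (\<lambda>\<omega>. trs p \<omega> ws)"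

lemma expectation_double_sum:
  fixes G :: "nat \<Rightarrow> nat \<Rightarrow> 'w \<Rightarrow> complex"
  assumes G: "\<And>i k. i < N \<Longrightarrow> k < N \<Longrightarrow> integrable M (\<lambda>\<omega>. G i k \<omega>)"
  shows "expectation (\<lambda>\<omega>. c * (\<Sum>i<N. \<Sum>k<N. G i k \<omega>)) = c * (\<Sum>i<N. \<Sum>k<N. expectation (\<lambda>\<omega>. G i k \<omega>))"
proof -
  have "expectation (\<lambda>\<omega>. \<Sum>i<N. \<Sum>k<N. G i k \<omega>) = (\<Sum>i<N. expectation (\<lambda>\<omega>. \<Sum>k<N. G i k \<omega>))"
    by (rule Bochner_Integration.integral_sum) (use G in \<open>auto intro!: Bochner_Integration.integrable_sum\<close>)
  also have "\<dots> = (\<Sum>i<N. \<Sum>k<N. expectation (\<lambda>\<omega>. G i k \<omega>))"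
    by (intro sum.cong refl Bochner_Integration.integral_sum) (use G in auto)
  finally show ?thesis by (simp only: integral_mult_right_zero)
qed

lemma expectation_sum_list:
  fixes g :: "'z \<Rightarrow> 'w \<Rightarrow> complex"
  assumes "\<And>x. integrable M (\<lambda>\<omega>. g x \<omega>)"
  shows "integrable M (\<lambda>\<omega>. \<Sum>x\<leftarrow>L. g x \<omega>)"
    "expectation (\<lambda>\<omega>. \<Sum>x\<leftarrow>L. g x \<omega>) = (\<Sum>x\<leftarrow>L. expectation (\<lambda>\<omega>. g x \<omega>))"
proof -
  have "integrable M (\<lambda>\<omega>. \<Sum>x\<leftarrow>L. g x \<omega>) \<and>
    expectation (\<lambda>\<omega>. \<Sum>x\<leftarrow>L. g x \<omega>) = (\<Sum>x\<leftarrow>L. expectation (\<lambda>\<omega>. g x \<omega>))"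
    using assms by (induction L) simp_all
  then show "integrable M (\<lambda>\<omega>. \<Sum>x\<leftarrow>L. g x \<omega>)"
    "expectation (\<lambda>\<omega>. \<Sum>x\<leftarrow>L. g x \<omega>) = (\<Sum>x\<leftarrow>L. expectation (\<lambda>\<omega>. g x \<omega>))" by auto
qed

text \<open>The leading \<open>LH\<close> contributes the factor \<open>gue \<omega> i k\<close>, a
  linear form in direction \<open>gue_dir i k\<close>. The product rule then hits \<open>c\<close>,
  giving \<open>D1\<close>, or one of the other traces, giving \<open>D2\<close>.\<close>

lemma mixed_moment_loop_H:
  assumes p: "p permutes {..<N}"
  shows "mixed_moment p ((LH # c) # ws) =
    (\<Sum>(u, v)\<leftarrow>splits c. mixed_moment p (u # v # ws)) +
    (\<Sum>(w, r)\<leftarrow>picks ws. \<Sum>(u, v)\<leftarrow>splits w. mixed_moment p ((c @ v @ u) # r)) / (of_nat N)\<^sup>2"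
proof -
  define D1 where "D1 i k \<omega> = (\<Sum>(u, v)\<leftarrow>splits c. ent p \<omega> u k k * ent p \<omega> v i i / of_nat N)" for i k \<omega>
  define D2 where "D2 i k \<omega> = (\<Sum>(w, r)\<leftarrow>picks ws.
    (\<Sum>(u, v)\<leftarrow>splits w. ent p \<omega> (v @ u) i k / (of_nat N)\<^sup>2) * trs p \<omega> r)" for i k \<omega>
  have dp: "deriv_pair (gue_dir i k) (\<lambda>\<omega>. ent p \<omega> c k i * trs p \<omega> ws)
    (\<lambda>\<omega>. D1 i k \<omega> * trs p \<omega> ws + ent p \<omega> c k i * D2 i k \<omega>)" if "i < N" "k < N" for i k
    unfolding D1_def D2_def using that
    by (intro deriv_pair_mult[OF deriv_pair_entry[OF p] deriv_pair_word_traces[OF p]])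
  have int1: "integrable M (\<lambda>\<omega>. gue \<omega> i k * (ent p \<omega> c k i * trs p \<omega> ws))"
    and int2: "integrable M (\<lambda>\<omega>. D1 i k \<omega> * trs p \<omega> ws + ent p \<omega> c k i * D2 i k \<omega>)"
    and eq: "expectation (\<lambda>\<omega>. gue \<omega> i k * (ent p \<omega> c k i * trs p \<omega> ws)) =
      expectation (\<lambda>\<omega>. D1 i k \<omega> * trs p \<omega> ws + ent p \<omega> c k i * D2 i k \<omega>)" if "i < N" "k < N" for i k
    using gaussian_by_parts[OF dp[OF that]] linear_form_gue_dir[OF that] by simp_all
  have "mixed_moment p ((LH # c) # ws) =
      expectation (\<lambda>\<omega>. 1 / of_nat N * (\<Sum>i<N. \<Sum>k<N. gue \<omega> i k * (ent p \<omega> c k i * trs p \<omega> ws)))"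
  proof -
    have "trs p \<omega> ((LH # c) # ws) =
        1 / of_nat N * (\<Sum>i<N. \<Sum>k<N. gue \<omega> i k * (ent p \<omega> c k i * trs p \<omega> ws))" for \<omega>
      unfolding list.map prod_list.Cons word_trace_def[of N p "gue \<omega>" "LH # c"] entry.simps
      by (simp only: sum_distrib_right sum_divide_distrib mult.assoc sum_distrib_left divide_inverse
          mult_1_left ac_simps)
    then show ?thesis unfolding mixed_moment_def by simp
  qed
  also have "\<dots> = 1 / of_nat N * (\<Sum>i<N. \<Sum>k<N. expectation (\<lambda>\<omega>. gue \<omega> i k * (ent p \<omega> c k i * trs p \<omega> ws)))"
    by (rule expectation_double_sum[OF int1])
  also have "\<dots> = 1 / of_nat N * (\<Sum>i<N. \<Sum>k<N.
      expectation (\<lambda>\<omega>. D1 i k \<omega> * trs p \<omega> ws + ent p \<omega> c k i * D2 i k \<omega>))"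
    by (intro arg_cong2[where f = "(*)"] sum.cong refl eq) auto
  also have "\<dots> = expectation (\<lambda>\<omega>. 1 / of_nat N * (\<Sum>i<N. \<Sum>k<N. D1 i k \<omega> * trs p \<omega> ws + ent p \<omega> c k i * D2 i k \<omega>))"
    by (rule expectation_double_sum[OF int2, symmetric])
  also have "(\<lambda>\<omega>. 1 / of_nat N * (\<Sum>i<N. \<Sum>k<N. D1 i k \<omega> * trs p \<omega> ws + ent p \<omega> c k i * D2 i k \<omega>)) =
    (\<lambda>\<omega>. (\<Sum>(u, v)\<leftarrow>splits c. trs p \<omega> (u # v # ws)) +
      (\<Sum>(w, r)\<leftarrow>picks ws. \<Sum>(u, v)\<leftarrow>splits w. trs p \<omega> ((c @ v @ u) # r)) / (of_nat N)\<^sup>2)"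
  proof (rule ext)
    fix \<omega>
    \<comment> \<open>Two closed paths appear, and the two available factors \<open>1 / N\<close>
      are exactly the normalizations of their traces: no power of \<open>N\<close> is left.\<close>
    have outer: "1 / of_nat N * (\<Sum>i<N. \<Sum>k<N. ent p \<omega> u k k * ent p \<omega> v i i / of_nat N * trs p \<omega> ws) =
        trs p \<omega> (u # v # ws)" for u v
    proof -
      have "(\<Sum>i<N. \<Sum>k<N. ent p \<omega> u k k * ent p \<omega> v i i / of_nat N * trs p \<omega> ws) =
        (\<Sum>k<N. ent p \<omega> u k k) * (\<Sum>i<N. ent p \<omega> v i i) / of_nat N * trs p \<omega> ws"
        unfolding sum_product unfolding sum_divide_distrib sum_distrib_right by (rule sum.swap)
      then show ?thesis by (simp only: word_trace_def list.map prod_list.Cons) simp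
    qed
    have "1 / of_nat N * (\<Sum>i<N. \<Sum>k<N. D1 i k \<omega> * trs p \<omega> ws) =
        (\<Sum>(u, v)\<leftarrow>splits c. 1 / of_nat N * (\<Sum>i<N. \<Sum>k<N. ent p \<omega> u k k * ent p \<omega> v i i / of_nat N * trs p \<omega> ws))"
      unfolding D1_def sum_list_mult_const[symmetric] sum_sum_list_swap sum_list_const_mult[symmetric]
      by (simp only: case_prod_beta')
    then have 1: "1 / of_nat N * (\<Sum>i<N. \<Sum>k<N. D1 i k \<omega> * trs p \<omega> ws) =
      (\<Sum>(u, v)\<leftarrow>splits c. trs p \<omega> (u # v # ws))" unfolding outer .
    \<comment> \<open>The sums over \<open>i\<close> and \<open>k\<close> close up a single path,
      which absorbs one factor \<open>1 / N\<close>; the remaining \<open>N^-2\<close> is the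
      suppression.\<close>
    have inner: "1 / of_nat N * (\<Sum>i<N. \<Sum>k<N. ent p \<omega> c k i * (ent p \<omega> (v @ u) i k / (of_nat N)\<^sup>2 * trs p \<omega> r)) =
        trs p \<omega> ((c @ v @ u) # r) / (of_nat N)\<^sup>2" for u v r
    proof -
      have e: "(\<Sum>i<N. ent p \<omega> c k i * ent p \<omega> (v @ u) i k) = ent p \<omega> (c @ v @ u) k k" if "k < N" for k
        by (rule entry_append[OF p that, symmetric])
      have "(\<Sum>i<N. \<Sum>k<N. ent p \<omega> c k i * (ent p \<omega> (v @ u) i k / (of_nat N)\<^sup>2 * trs p \<omega> r)) =
        (\<Sum>k<N. (\<Sum>i<N. ent p \<omega> c k i * ent p \<omega> (v @ u) i k) / (of_nat N)\<^sup>2 * trs p \<omega> r)"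
        by (subst sum.swap) (simp only: sum_distrib_right sum_divide_distrib mult.assoc
            times_divide_eq_right times_divide_eq_left)
      also have "\<dots> = (\<Sum>k<N. ent p \<omega> (c @ v @ u) k k / (of_nat N)\<^sup>2 * trs p \<omega> r)"
        by (rule sum.cong[OF refl]) (simp only: e lessThan_iff)
      also have "\<dots> = (\<Sum>k<N. ent p \<omega> (c @ v @ u) k k) / (of_nat N)\<^sup>2 * trs p \<omega> r"
        by (simp only: sum_divide_distrib sum_distrib_right)
      finally show ?thesis by (simp only: word_trace_def list.map prod_list.Cons) simp
    qed
    have "1 / of_nat N * (\<Sum>i<N. \<Sum>k<N. ent p \<omega> c k i * D2 i k \<omega>) =
      (\<Sum>(w, r)\<leftarrow>picks ws. \<Sum>(u, v)\<leftarrow>splits w.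
        1 / of_nat N * (\<Sum>i<N. \<Sum>k<N. ent p \<omega> c k i * (ent p \<omega> (v @ u) i k / (of_nat N)\<^sup>2 * trs p \<omega> r)))"
      unfolding D2_def sum_list_mult_const[symmetric] case_prod_beta' sum_list_const_mult[symmetric] sum_sum_list_swap ..
    also have "\<dots> = (\<Sum>(w, r)\<leftarrow>picks ws. \<Sum>(u, v)\<leftarrow>splits w. trs p \<omega> ((c @ v @ u) # r)) / (of_nat N)\<^sup>2"
      unfolding inner by (simp only: divide_inverse sum_list_mult_const[symmetric] case_prod_beta')
    finally show "1 / of_nat N * (\<Sum>i<N. \<Sum>k<N. D1 i k \<omega> * trs p \<omega> ws + ent p \<omega> c k i * D2 i k \<omega>) =
      (\<Sum>(u, v)\<leftarrow>splits c. trs p \<omega> (u # v # ws)) +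
      (\<Sum>(w, r)\<leftarrow>picks ws. \<Sum>(u, v)\<leftarrow>splits w. trs p \<omega> ((c @ v @ u) # r)) / (of_nat N)\<^sup>2"
      unfolding sum.distrib distrib_left 1 by simp
  qed
  also have "expectation \<dots> = (\<Sum>(u, v)\<leftarrow>splits c. mixed_moment p (u # v # ws)) +
    (\<Sum>(w, r)\<leftarrow>picks ws. \<Sum>(u, v)\<leftarrow>splits w. mixed_moment p ((c @ v @ u) # r)) / (of_nat N)\<^sup>2"
  proof -
    note int = integrable_word_traces[OF p]
    have A: "integrable M (\<lambda>\<omega>. \<Sum>x\<leftarrow>splits c. trs p \<omega> (fst x # snd x # ws))"
      by (rule expectation_sum_list(1)[OF int])
    have A': "expectation (\<lambda>\<omega>. \<Sum>x\<leftarrow>splits c. trs p \<omega> (fst x # snd x # ws)) =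
        (\<Sum>x\<leftarrow>splits c. mixed_moment p (fst x # snd x # ws))"
      unfolding mixed_moment_def by (rule expectation_sum_list(2)[OF int])
    have B: "integrable M (\<lambda>\<omega>. \<Sum>y\<leftarrow>picks ws. \<Sum>x\<leftarrow>splits (fst y). trs p \<omega> ((c @ snd x @ fst x) # snd y))"
      by (rule expectation_sum_list(1), rule expectation_sum_list(1)[OF int])
    have "expectation (\<lambda>\<omega>. \<Sum>y\<leftarrow>picks ws. \<Sum>x\<leftarrow>splits (fst y). trs p \<omega> ((c @ snd x @ fst x) # snd y)) =
        (\<Sum>y\<leftarrow>picks ws. expectation (\<lambda>\<omega>. \<Sum>x\<leftarrow>splits (fst y). trs p \<omega> ((c @ snd x @ fst x) # snd y)))"
      by (rule expectation_sum_list(2), rule expectation_sum_list(1)[OF int])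
    also have "\<dots> = (\<Sum>y\<leftarrow>picks ws. \<Sum>x\<leftarrow>splits (fst y). mixed_moment p ((c @ snd x @ fst x) # snd y))"
      unfolding mixed_moment_def by (simp only: expectation_sum_list(2)[OF int])
    finally have B': "expectation (\<lambda>\<omega>. \<Sum>y\<leftarrow>picks ws. \<Sum>x\<leftarrow>splits (fst y). trs p \<omega> ((c @ snd x @ fst x) # snd y)) =
        (\<Sum>y\<leftarrow>picks ws. \<Sum>x\<leftarrow>splits (fst y). mixed_moment p ((c @ snd x @ fst x) # snd y))" .
    show ?thesis
      unfolding case_prod_beta' Bochner_Integration.integral_add[OF A integrable_divide_zero[OF B]]
        integral_divide_zero A' B' ..
  qed
  finally show ?thesis .
qed

text \<open>Integration by parts in the entries of the distinguished \<open>LH\<close> pairs it with every other \<open>LH\<close>: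
  a partner in the same word cuts the cyclic word in two, a partner in another word merges the two
  words at the cost of a factor \<open>N\<^sup>-\<^sup>2\<close>.\<close>

lemma mixed_moment_loop:
  assumes p: "p permutes {..<N}"
  shows "mixed_moment p ((a @ LH # b) # ws) =
    (\<Sum>(u, v)\<leftarrow>splits (b @ a). mixed_moment p (u # v # ws)) +
    (\<Sum>(w, r)\<leftarrow>picks ws. \<Sum>(u, v)\<leftarrow>splits w. mixed_moment p (((b @ a) @ v @ u) # r)) / (of_nat N)\<^sup>2"
proof -
  have "mixed_moment p ((a @ LH # b) # ws) = mixed_moment p ((LH # b @ a) # ws)"
    using word_trace_cyclic[OF p, of _ a "LH # b"] by (simp add: mixed_moment_def)
  then show ?thesis using mixed_moment_loop_H[OF p] by simp
qed

end

section \<open>Asymptotics of the loop equations\<close>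

fun letter_charge :: "letter \<Rightarrow> int" where
  "letter_charge LH = 0"
| "letter_charge LU = 1"
| "letter_charge LUi = -1"

definition charge :: "letter list \<Rightarrow> int" where
  "charge w = (\<Sum>l\<leftarrow>w. letter_charge l)"

lemma charge_simps [simp]:
  "charge [] = 0" "charge (l # w) = letter_charge l + charge w" "charge (u @ v) = charge u + charge v"
  by (simp_all add: charge_def)

abbreviation "num_H w \<equiv> count_list w LH"

lemma splits_append:
  "splits (w @ x) = map (\<lambda>(u, v). (u, v @ x)) (splits w) @ map (\<lambda>(u, v). (w @ u, v)) (splits x)"
  by (induction w) (auto simp: comp_def case_prod_beta')

subsection \<open>Words without the Gaussian letter\<close>

text \<open>The action of a power of the permutation matrix on row indices: positive exponents
  iterate the inverse of \<open>p\<close>, matching \<open>entry\<close> on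
  \<open>LU\<close>.\<close>

definition perm_zpow :: "(nat \<Rightarrow> nat) \<Rightarrow> int \<Rightarrow> nat \<Rightarrow> nat" where
  "perm_zpow p m = (if m \<ge> 0 then inv_into UNIV p ^^ nat m else p ^^ nat (- m))"

lemma perm_zpow_inv:
  assumes "bij p"
  shows "perm_zpow p m (inv_into UNIV p i) = perm_zpow p (m + 1) i"
proof (cases "m \<ge> 0")
  case True
  then have "nat (m + 1) = Suc (nat m)" by simp
  then show ?thesis using True by (simp add: perm_zpow_def funpow_swap1)
next
  case False
  define n where "n = nat (- m) - 1"
  have n: "nat (- m) = Suc n" "m = - int n - 1" using False by (auto simp: n_def)
  have "perm_zpow p m (inv_into UNIV p i) = (p ^^ n) (p (inv_into UNIV p i))"
    using False n(1) by (simp add: perm_zpow_def funpow_swap1)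
  also have "p (inv_into UNIV p i) = i" using assms by (simp add: bij_is_surj surj_f_inv_f)
  also have "(p ^^ n) i = perm_zpow p (m + 1) i"
    by (cases "n = 0") (simp_all add: perm_zpow_def n(2))
  finally show ?thesis .
qed

lemma perm_zpow_perm:
  assumes "bij p"
  shows "perm_zpow p m (p i) = perm_zpow p (m - 1) i"
  using perm_zpow_inv[OF assms, of "m - 1" "p i"] assms
  by (simp add: bij_is_inj)

lemma entry_no_H:
  assumes "bij p" "LH \<notin> set w"
  shows "entry N p h w i j = (if perm_zpow p (charge w) i = j then 1 else 0)"
  using assms(2)
proof (induction w arbitrary: i)
  case Nil
  show ?case by (simp add: perm_zpow_def)
next
  case (Cons l w)
  then show ?case
    by (cases l) (simp_all add: perm_zpow_inv[OF assms(1)] perm_zpow_perm[OF assms(1)] add.commute)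
qed

lemma perm_zpow_fixed_iff:
  assumes "bij p"
  shows "perm_zpow p m i = i \<longleftrightarrow> (p ^^ nat \<bar>m\<bar>) i = i"
proof (cases "m \<ge> 0")
  case True
  have "(inv_into UNIV p ^^ nat m) i = i \<longleftrightarrow> inv_into UNIV (p ^^ nat m) i = i"
    using inv_fn[OF assms, of "nat m"] by simp
  also have "\<dots> \<longleftrightarrow> (p ^^ nat m) i = i"
    using bij_inv_eq_iff[OF bij_fn[OF assms], of i "nat m" i] by metis
  finally show ?thesis using True by (simp add: perm_zpow_def)
qed (simp add: perm_zpow_def)

definition fixed_ratio :: "nat \<Rightarrow> (nat \<Rightarrow> nat) \<Rightarrow> int \<Rightarrow> real" where
  "fixed_ratio N p m = real (card {i. i < N \<and> (p ^^ nat \<bar>m\<bar>) i = i}) / real N"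

lemma word_trace_no_H:
  assumes "bij p" "LH \<notin> set w"
  shows "word_trace N p h w = complex_of_real (fixed_ratio N p (charge w))"
proof -
  have "(\<Sum>i<N. entry N p h w i i) = (\<Sum>i<N. if (p ^^ nat \<bar>charge w\<bar>) i = i then 1 else 0)"
    unfolding entry_no_H[OF assms] perm_zpow_fixed_iff[OF assms(1)] ..
  also have "\<dots> = of_nat (card {i. i < N \<and> (p ^^ nat \<bar>charge w\<bar>) i = i})"
    by (simp add: sum.If_cases Int_def)
  finally show ?thesis by (simp add: word_trace_def fixed_ratio_def)
qed

lemma fixed_ratio_0: "N > 0 \<Longrightarrow> fixed_ratio N p 0 = 1"
  by (simp add: fixed_ratio_def)

lemma fixed_ratio_bounds: "0 \<le> fixed_ratio N p m" "fixed_ratio N p m \<le> 1"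
proof -
  have "card {i. i < N \<and> (p ^^ nat \<bar>m\<bar>) i = i} \<le> card {..<N}"
    by (rule card_mono) auto
  then show "fixed_ratio N p m \<le> 1" by (simp add: fixed_ratio_def divide_le_eq)
qed (simp add: fixed_ratio_def)

lemma prod_list_le_member:
  fixes x :: "'a \<Rightarrow> real"
  assumes "\<And>w. 0 \<le> x w" "\<And>w. x w \<le> 1"
  shows "0 \<le> (\<Prod>w\<leftarrow>ws. x w)" "(\<Prod>w\<leftarrow>ws. x w) \<le> 1" "w \<in> set ws \<Longrightarrow> (\<Prod>w\<leftarrow>ws. x w) \<le> x w"
proof -
  show 0: "0 \<le> (\<Prod>w\<leftarrow>ws. x w)" for ws using assms by (induction ws) auto
  show 1: "(\<Prod>w\<leftarrow>ws. x w) \<le> 1" for ws using assms 0 by (induction ws) (auto intro: mult_le_one)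
  show "w \<in> set ws \<Longrightarrow> (\<Prod>w\<leftarrow>ws. x w) \<le> x w"
  proof (induction ws)
    case (Cons y ws)
    show ?case
    proof (cases "y = w")
      case True
      then show ?thesis using 1[of ws] assms(1)[of w] by (simp add: mult_left_le)
    next
      case False
      then have "(\<Prod>w\<leftarrow>ws. x w) \<le> x w" using Cons by auto
      then have "x y * (\<Prod>w\<leftarrow>ws. x w) \<le> 1 * x w"
        using assms 0 by (intro mult_mono) auto
      then show ?thesis by simp
    qed
  qed simp
qed

text \<open>If some word is charged, its factor bounds the whole product, all factors lying in
  [0, 1]; so the joint distribution of the fixed point counts never enters.\<close>

lemma average_no_H_tendsto:
  "(\<lambda>N. (\<Sum>p | p permutes {..<N}. \<Prod>w\<leftarrow>ws. complex_of_real (fixed_ratio N p (charge w))) / fact N)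
    \<longlonglongrightarrow> (\<Prod>w\<leftarrow>ws. if charge w = 0 then 1 else 0)"
proof (cases "\<forall>w\<in>set ws. charge w = 0")
  case True
  have p1: "(\<Prod>w\<leftarrow>ws. if charge w = 0 then 1 else 0 :: complex) = 1"
    using True by (induction ws) auto
  have p2: "(\<Prod>w\<leftarrow>ws. complex_of_real (fixed_ratio N p (charge w))) = 1" if "N > 0" for N p
    using True that by (induction ws) (auto simp: fixed_ratio_0)
  have "(\<Sum>p | p permutes {..<N}. \<Prod>w\<leftarrow>ws. complex_of_real (fixed_ratio N p (charge w))) / fact N = 1"
    if "N \<ge> 1" for N
  proof -
    have "card {p. p permutes {..<N}} = fact N" by (rule card_permutations) simp_all
    then show ?thesis using p2[of N] that by simp
  qed
  then show ?thesis unfolding p1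
    by (intro tendsto_eventually eventually_sequentiallyI[of 1]) blast
next
  case False
  then obtain w where w: "w \<in> set ws" "charge w \<noteq> 0" by blast
  have p0: "(\<Prod>w\<leftarrow>ws. if charge w = 0 then 1 else 0 :: complex) = 0"
    using w by (induction ws) auto
  have bound: "norm ((\<Sum>p | p permutes {..<N}. \<Prod>w\<leftarrow>ws. complex_of_real (fixed_ratio N p (charge w))) / fact N)
      \<le> (\<Sum>p | p permutes {..<N}. fixed_ratio N p (charge w)) / fact N" for N
  proof -
    have of_real_prod: "(\<Prod>w\<leftarrow>ws. complex_of_real (g w)) = complex_of_real (\<Prod>w\<leftarrow>ws. g w)" for g
      by (induction ws) auto
    have "norm (\<Sum>p | p permutes {..<N}. \<Prod>w\<leftarrow>ws. complex_of_real (fixed_ratio N p (charge w)))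
        \<le> (\<Sum>p | p permutes {..<N}. norm (\<Prod>w\<leftarrow>ws. complex_of_real (fixed_ratio N p (charge w))))"
      by (rule norm_sum)
    also have "\<dots> \<le> (\<Sum>p | p permutes {..<N}. fixed_ratio N p (charge w))"
    proof (rule sum_mono)
      fix p
      show "norm (\<Prod>w\<leftarrow>ws. complex_of_real (fixed_ratio N p (charge w))) \<le> fixed_ratio N p (charge w)"
        unfolding of_real_prod norm_of_real
        using prod_list_le_member(1)[of "\<lambda>w. fixed_ratio N p (charge w)" ws]
          prod_list_le_member(3)[of "\<lambda>w. fixed_ratio N p (charge w)" w ws] fixed_ratio_bounds w(1)
        by (simp only: abs_of_nonneg)
    qed
    finally show ?thesis by (simp add: norm_divide divide_right_mono)
  qed
  have "(\<lambda>N. (\<Sum>p | p permutes {..<N}. fixed_ratio N p (charge w)) / fact N) \<longlonglongrightarrow> 0"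
    unfolding fixed_ratio_def using w(2) by (intro average_fixed_points_tendsto_0) simp
  then show ?thesis unfolding p0
    by (rule Lim_null_comparison[rotated]) (use bound in simp)
qed

subsection \<open>The limits of the mixed moments\<close>

text \<open>The loop equation for one word with the \<open>N^-2\<close> term dropped and the trace
  product factorized. Starting from the first \<open>LH\<close> is a convention that makes this a
  function.\<close>

function word_limit :: "letter list \<Rightarrow> complex" where
  "word_limit w =
    (if LH \<in> set w then
       (\<Sum>(u, v)\<leftarrow>splits (tl (dropWhile (\<lambda>l. l \<noteq> LH) w) @ takeWhile (\<lambda>l. l \<noteq> LH) w). word_limit u * word_limit v)
     else if charge w = 0 then 1 else 0)"
  by auto
termination
\<comment> \<open>The distinguished and the cut letter are both gone, so \<open>u\<close> and
  \<open>v\<close> together have two letters \<open>LH\<close> fewer than \<open>w\<close>.\<close>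
proof (relation "Wellfounded.measure num_H", simp, goal_cases)
  case (1 w x u v)
  obtain a b where w: "w = a @ LH # b" "LH \<notin> set a" using 1(1) split_list_first by metis
  have "takeWhile (\<lambda>l. l \<noteq> LH) w = a" "tl (dropWhile (\<lambda>l. l \<noteq> LH) w) = b"
    using w by (simp_all add: takeWhile_append dropWhile_append)
  then have "b @ a = u @ LH # v" using 1 set_splits by auto
  then have "num_H (b @ a) = num_H (u @ LH # v)" by simp
  then show ?case using w by simp
next
  case (2 w x u v)
  obtain a b where w: "w = a @ LH # b" "LH \<notin> set a" using 2(1) split_list_first by metis
  have "takeWhile (\<lambda>l. l \<noteq> LH) w = a" "tl (dropWhile (\<lambda>l. l \<noteq> LH) w) = b"
    using w by (simp_all add: takeWhile_append dropWhile_append)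
  then have "b @ a = u @ LH # v" using 2 set_splits by auto
  then have "num_H (b @ a) = num_H (u @ LH # v)" by simp
  then show ?case using w by simp
qed

declare word_limit.simps [simp del]

lemma word_limit_no_H: "LH \<notin> set w \<Longrightarrow> word_limit w = (if charge w = 0 then 1 else 0)"
  by (simp add: word_limit.simps)

lemma word_limit_H:
  assumes "LH \<notin> set a"
  shows "word_limit (a @ LH # b) = (\<Sum>(u, v)\<leftarrow>splits (b @ a). word_limit u * word_limit v)"
proof -
  have "takeWhile (\<lambda>l. l \<noteq> LH) (a @ LH # b) = a" "tl (dropWhile (\<lambda>l. l \<noteq> LH) (a @ LH # b)) = b"
    using assms by (auto simp: takeWhile_append dropWhile_append)
  then show ?thesis by (subst word_limit.simps) simp
qed

text \<open>Both properties pass from the two pieces of a cut to the word: two letters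
  \<open>LH\<close> of charge zero are removed, and all other letters are distributed over the
  pieces.\<close>

lemma word_limit_nonzero:
  assumes "word_limit w \<noteq> 0"
  shows "even (num_H w) \<and> charge w = 0"
  using assms
proof (induction "num_H w" arbitrary: w rule: less_induct)
  case less
  show ?case
  proof (cases "LH \<in> set w")
    case False
    then show ?thesis using less.prems by (simp add: word_limit_no_H count_notin split: if_splits)
  next
    case True
    then obtain a b where w: "w = a @ LH # b" "LH \<notin> set a" using split_list_first by metis
    have sum_zero: "(\<Sum>x\<leftarrow>L. g x) = 0" if "\<And>x. x \<in> set L \<Longrightarrow> g x = (0::complex)"
      for L :: "(letter list \<times> letter list) list" and g
      using that by (induction L) auto
    have "\<exists>x\<in>set (splits (b @ a)). word_limit (fst x) * word_limit (snd x) \<noteq> 0"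
    proof (rule ccontr)
      assume "\<not> ?thesis"
      then have "(\<Sum>x\<leftarrow>splits (b @ a). word_limit (fst x) * word_limit (snd x)) = 0"
        by (intro sum_zero) blast
      then show False
        using less.prems unfolding w(1) word_limit_H[OF w(2)] case_prod_beta' by simp
    qed
    then obtain u v where uv: "(u, v) \<in> set (splits (b @ a))" "word_limit u * word_limit v \<noteq> 0"
      by (metis prod.collapse)
    have eq: "b @ a = u @ LH # v" using uv(1) by (simp add: set_splits)
    then have c: "charge (b @ a) = charge (u @ LH # v)" and n: "num_H (b @ a) = num_H (u @ LH # v)"
      by simp_all
    have "even (num_H u) \<and> charge u = 0" "even (num_H v) \<and> charge v = 0"
      using uv(2) n w(1) by (auto intro!: less.hyps)
    moreover have "num_H w = num_H u + num_H v + 2" using n w(1) by simp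
    ultimately show ?thesis using c w(1) by simp
  qed
qed

lemma tendsto_sum_list:
  fixes g :: "'a \<Rightarrow> nat \<Rightarrow> complex"
  assumes "\<And>x. x \<in> set L \<Longrightarrow> (\<lambda>n. g x n) \<longlonglongrightarrow> l x"
  shows "(\<lambda>n. \<Sum>x\<leftarrow>L. g x n) \<longlonglongrightarrow> (\<Sum>x\<leftarrow>L. l x)"
  using assms by (induction L) (auto intro!: tendsto_add)

text \<open>The induction counts letters \<open>LH\<close> over the whole list, which both cutting
  and merging lower by two. Applied to lists, the induction hypothesis provides the factorized limit
  of the cut terms directly.\<close>

lemma loop_equation_limit:
  fixes A :: "nat \<Rightarrow> letter list list \<Rightarrow> complex"
  assumes loop: "\<And>N a b ws. N \<ge> 1 \<Longrightarrow> A N ((a @ LH # b) # ws) =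
      (\<Sum>(u, v)\<leftarrow>splits (b @ a). A N (u # v # ws)) +
      (\<Sum>(w, r)\<leftarrow>picks ws. \<Sum>(u, v)\<leftarrow>splits w. A N (((b @ a) @ v @ u) # r)) / (of_nat N)\<^sup>2"
    and perm: "\<And>N us w vs. A N (us @ w # vs) = A N (w # us @ vs)"
    and no_H: "\<And>ws. \<forall>w\<in>set ws. LH \<notin> set w \<Longrightarrow>
      (\<lambda>N. A N ws) \<longlonglongrightarrow> (\<Prod>w\<leftarrow>ws. if charge w = 0 then 1 else 0)"
  shows "(\<lambda>N. A N ws) \<longlonglongrightarrow> (\<Prod>w\<leftarrow>ws. word_limit w)"
proof (induction "\<Sum>w\<leftarrow>ws. num_H w" arbitrary: ws rule: less_induct)
  case less
  show ?case
  proof (cases "\<forall>w\<in>set ws. LH \<notin> set w")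
    case True
    then have "map (\<lambda>w. if charge w = 0 then 1 else 0) ws = map word_limit ws"
      by (simp add: word_limit_no_H)
    then have "(\<Prod>w\<leftarrow>ws. if charge w = 0 then 1 else 0) = (\<Prod>w\<leftarrow>ws. word_limit w)"
      by (rule arg_cong)
    then show ?thesis using no_H[OF True] by (simp only:)
  next
    case False
    then obtain w where w: "w \<in> set ws" "LH \<in> set w" by blast
    obtain us vs where ws: "ws = us @ w # vs" using w(1) split_list by metis
    \<comment> \<open>Taking the first \<open>LH\<close> matches the choice made in
      \<open>word_limit\<close>.\<close>
    obtain a b where ab: "w = a @ LH # b" "LH \<notin> set a" using w(2) split_list_first by metis
    have num: "(\<Sum>w\<leftarrow>ws. num_H w) = Suc (num_H a + num_H b) + (\<Sum>w\<leftarrow>us @ vs. num_H w)"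
      by (simp add: ws ab)
    have 1: "(\<lambda>N. \<Sum>x\<leftarrow>splits (b @ a). A N (fst x # snd x # us @ vs)) \<longlonglongrightarrow>
        (\<Sum>x\<leftarrow>splits (b @ a). \<Prod>w\<leftarrow>fst x # snd x # us @ vs. word_limit w)"
    proof (intro tendsto_sum_list less.hyps)
      fix x assume "x \<in> set (splits (b @ a))"
      then have "b @ a = fst x @ LH # snd x" by (auto simp: set_splits)
      then have "num_H (b @ a) = num_H (fst x @ LH # snd x)" by simp
      then show "(\<Sum>w\<leftarrow>fst x # snd x # us @ vs. num_H w) < (\<Sum>w\<leftarrow>ws. num_H w)"
        unfolding num by simp
    qed
    \<comment> \<open>The value of this limit is irrelevant; convergence suffices for the factor
      \<open>N^-2\<close> to remove the merged terms.\<close>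
    have 2: "(\<lambda>N. \<Sum>y\<leftarrow>picks (us @ vs). \<Sum>x\<leftarrow>splits (fst y). A N (((b @ a) @ snd x @ fst x) # snd y)) \<longlonglongrightarrow>
        (\<Sum>y\<leftarrow>picks (us @ vs). \<Sum>x\<leftarrow>splits (fst y). \<Prod>w\<leftarrow>((b @ a) @ snd x @ fst x) # snd y. word_limit w)"
    proof (intro tendsto_sum_list less.hyps)
      fix y x assume y: "y \<in> set (picks (us @ vs))" and x: "x \<in> set (splits (fst y))"
      have "(fst y, snd y) \<in> set (picks (us @ vs))" using y by simp
      from set_picks[OF this] obtain as bs where y': "us @ vs = as @ fst y # bs" "snd y = as @ bs"
        by blast
      have x': "fst y = fst x @ LH # snd x" using x by (auto simp: set_splits)
      have "(\<Sum>w\<leftarrow>us @ vs. num_H w) = (\<Sum>w\<leftarrow>snd y. num_H w) + Suc (num_H (fst x) + num_H (snd x))"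
        using x' by (simp only: y') simp
      then show "(\<Sum>w\<leftarrow>((b @ a) @ snd x @ fst x) # snd y. num_H w) < (\<Sum>w\<leftarrow>ws. num_H w)"
        unfolding num by simp
    qed
    have inv: "(\<lambda>N. 1 / (of_nat N)\<^sup>2 :: complex) \<longlonglongrightarrow> 0"
      using tendsto_power[OF lim_1_over_n[where 'a = complex], of 2] by (simp add: power_divide)
    have "(\<lambda>N. (\<Sum>x\<leftarrow>splits (b @ a). A N (fst x # snd x # us @ vs)) +
        (\<Sum>y\<leftarrow>picks (us @ vs). \<Sum>x\<leftarrow>splits (fst y). A N (((b @ a) @ snd x @ fst x) # snd y)) * (1 / (of_nat N)\<^sup>2))
      \<longlonglongrightarrow> (\<Sum>x\<leftarrow>splits (b @ a). \<Prod>w\<leftarrow>fst x # snd x # us @ vs. word_limit w)"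
      using tendsto_add[OF 1 tendsto_mult[OF 2 inv]] by simp
    moreover have "(\<Sum>x\<leftarrow>splits (b @ a). \<Prod>w\<leftarrow>fst x # snd x # us @ vs. word_limit w) = (\<Prod>w\<leftarrow>ws. word_limit w)"
    proof -
      have "(\<Sum>x\<leftarrow>splits (b @ a). \<Prod>w\<leftarrow>fst x # snd x # us @ vs. word_limit w) =
          (\<Sum>x\<leftarrow>splits (b @ a). word_limit (fst x) * word_limit (snd x)) * (\<Prod>w\<leftarrow>us @ vs. word_limit w)"
        by (simp add: sum_list_mult_const mult.assoc[symmetric] del: map_append prod_list.append)
      also have "(\<Sum>x\<leftarrow>splits (b @ a). word_limit (fst x) * word_limit (snd x)) = word_limit w"
        unfolding ab(1) word_limit_H[OF ab(2)] by (simp only: case_prod_beta')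
      finally show ?thesis by (simp add: ws mult_ac)
    qed
    moreover have "A N ws = (\<Sum>x\<leftarrow>splits (b @ a). A N (fst x # snd x # us @ vs)) +
        (\<Sum>y\<leftarrow>picks (us @ vs). \<Sum>x\<leftarrow>splits (fst y). A N (((b @ a) @ snd x @ fst x) # snd y)) * (1 / (of_nat N)\<^sup>2)"
      if "N \<ge> 1" for N
      unfolding ws perm ab(1) loop[OF that] by (simp only: case_prod_beta' times_divide_eq_right mult_1_right)
    then have "\<forall>\<^sub>F N in sequentially. (\<Sum>x\<leftarrow>splits (b @ a). A N (fst x # snd x # us @ vs)) +
        (\<Sum>y\<leftarrow>picks (us @ vs). \<Sum>x\<leftarrow>splits (fst y). A N (((b @ a) @ snd x @ fst x) # snd y)) * (1 / (of_nat N)\<^sup>2)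
        = A N ws"
      by (intro eventually_sequentiallyI[of 1]) simp
    ultimately show ?thesis by (simp only: Lim_transform_eventually)
  qed
qed

subsection \<open>Words in \<open>X\<close> and its adjoint\<close>

text \<open>With \<open>H\<close> self-adjoint, the adjoint of the product of \<open>U\<close> and
  \<open>H\<close> is \<open>H\<close> times the inverse of \<open>U\<close>.\<close>

fun exponent_letters :: "star_exponent \<Rightarrow> letter list" where
  "exponent_letters Plain = [LU, LH]"
| "exponent_letters Star = [LH, LUi]"

definition circ_word :: "star_exponent list \<Rightarrow> letter list" where
  "circ_word es = concat (map exponent_letters es)"

lemma circ_word_simps [simp]:
  "circ_word [] = []" "circ_word (e # es) = exponent_letters e @ circ_word es"
  by (simp_all add: circ_word_def)

fun before_H :: "star_exponent \<Rightarrow> letter list" where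
  "before_H Plain = [LU]" | "before_H Star = []"

fun after_H :: "star_exponent \<Rightarrow> letter list" where
  "after_H Plain = []" | "after_H Star = [LUi]"

text \<open>Each exponent contributes exactly one \<open>LH\<close>, so cuts correspond to positions
  in \<open>es\<close>; \<open>before_H\<close> and \<open>after_H\<close> are what remains of the
  cut exponent on either side.\<close>

lemma splits_circ_word:
  "splits (circ_word es) =
    map (\<lambda>b. (circ_word (take b es) @ before_H (es ! b), after_H (es ! b) @ circ_word (drop (Suc b) es)))
      [0..<length es]"
proof (induction es)
  case (Cons e es)
  have e: "splits (exponent_letters e) = [(before_H e, after_H e)]" by (cases e) auto
  show ?case
    unfolding circ_word_simps splits_append e Cons.IH
    by (simp add: upt_conv_Cons comp_def map_Suc_upt[symmetric] del: upt_Suc)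
qed simp

lemma num_H_circ_word: "num_H (circ_word es) = length es"
proof (induction es)
  case (Cons e es) then show ?case by (cases e) auto
qed simp

lemma even_charge_circ_word: "even (charge (circ_word es)) \<longleftrightarrow> even (length es)"
proof (induction es)
  case (Cons e es) then show ?case by (cases e) auto
qed simp

text \<open>In a word in \<open>X\<close> and its adjoint the charge and the number of letters \<open>LH\<close> have the same
  parity, so one additional letter \<open>LU\<close> or \<open>LUi\<close> makes the limit vanish. This is what rules out
  pairings of \<open>X\<close> with \<open>X\<close>.\<close>

lemma word_limit_circ_word_charged:
  "word_limit (circ_word es @ [LU]) = 0" "word_limit (LUi # circ_word es) = 0"
proof -
  have *: "charge (circ_word es) \<noteq> 1" "charge (circ_word es) \<noteq> - 1" if "even (length es)"
    using that even_charge_circ_word[of es] by auto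
  show "word_limit (circ_word es @ [LU]) = 0"
    using word_limit_nonzero[of "circ_word es @ [LU]"] * by (force simp: num_H_circ_word)
  show "word_limit (LUi # circ_word es) = 0"
    using word_limit_nonzero[of "LUi # circ_word es"] * by (force simp: num_H_circ_word)
qed

text \<open>Removing the \<open>LH\<close> of \<open>e\<close> leaves one letter \<open>LU\<close>
  or \<open>LUi\<close>, moved to an end of the rotated word. A partner of opposite exponent puts
  the inverse letter at the other end of the same piece, where \<open>conj\<close> cancels both; a
  partner of equal exponent leaves an unbalanced letter and a zero factor.\<close>

lemma word_limit_circ_word_Cons:
  assumes conj: "\<And>w. word_limit (LUi # w @ [LU]) = word_limit w"
  shows "word_limit (circ_word (e # es)) =
    (\<Sum>b<length es. if es ! b \<noteq> e then
      word_limit (circ_word (take b es)) * word_limit (circ_word (drop (Suc b) es)) else 0)"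
proof (cases e)
  case Star
  have "word_limit (circ_word (e # es)) =
      (\<Sum>(u, v)\<leftarrow>splits (LUi # circ_word es). word_limit u * word_limit v)"
    using word_limit_H[of "[]" "LUi # circ_word es"] Star by simp
  also have "\<dots> = (\<Sum>b\<leftarrow>[0..<length es]. word_limit (LUi # circ_word (take b es) @ before_H (es ! b)) *
      word_limit (after_H (es ! b) @ circ_word (drop (Suc b) es)))"
    by (simp add: splits_circ_word comp_def)
  also have "\<dots> = (\<Sum>b<length es. word_limit (LUi # circ_word (take b es) @ before_H (es ! b)) *
      word_limit (after_H (es ! b) @ circ_word (drop (Suc b) es)))"
    by (simp add: interv_sum_list_conv_sum_set_nat lessThan_atLeast0)
  also have "\<dots> = (\<Sum>b<length es. if es ! b \<noteq> e then
      word_limit (circ_word (take b es)) * word_limit (circ_word (drop (Suc b) es)) else 0)"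
  proof (rule sum.cong[OF refl])
    fix b
    show "word_limit (LUi # circ_word (take b es) @ before_H (es ! b)) *
      word_limit (after_H (es ! b) @ circ_word (drop (Suc b) es)) = (if es ! b \<noteq> e then
      word_limit (circ_word (take b es)) * word_limit (circ_word (drop (Suc b) es)) else 0)"
      using Star by (cases "es ! b") (simp_all add: conj word_limit_circ_word_charged)
  qed
  finally show ?thesis .
next
  case Plain
  have "word_limit (circ_word (e # es)) =
      (\<Sum>(u, v)\<leftarrow>splits (circ_word es @ [LU]). word_limit u * word_limit v)"
    using word_limit_H[of "[LU]" "circ_word es"] Plain by simp
  also have "\<dots> = (\<Sum>b\<leftarrow>[0..<length es]. word_limit (circ_word (take b es) @ before_H (es ! b)) *
      word_limit (after_H (es ! b) @ circ_word (drop (Suc b) es) @ [LU]))"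
    by (simp add: splits_append splits_circ_word comp_def)
  also have "\<dots> = (\<Sum>b<length es. word_limit (circ_word (take b es) @ before_H (es ! b)) *
      word_limit (after_H (es ! b) @ circ_word (drop (Suc b) es) @ [LU]))"
    by (simp add: interv_sum_list_conv_sum_set_nat lessThan_atLeast0)
  also have "\<dots> = (\<Sum>b<length es. if es ! b \<noteq> e then
      word_limit (circ_word (take b es)) * word_limit (circ_word (drop (Suc b) es)) else 0)"
  proof (rule sum.cong[OF refl])
    fix b
    show "word_limit (circ_word (take b es) @ before_H (es ! b)) *
      word_limit (after_H (es ! b) @ circ_word (drop (Suc b) es) @ [LU]) = (if es ! b \<noteq> e then
      word_limit (circ_word (take b es)) * word_limit (circ_word (drop (Suc b) es)) else 0)"
      using Plain by (cases "es ! b") (simp_all add: conj word_limit_circ_word_charged)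
  qed
  finally show ?thesis .
qed

section \<open>Random matrices\<close>

context gue_model
begin

text \<open>A finite uniform average over permutations, outside the Gaussian expectation;
  independence of \<open>U\<close> later identifies it with the expectation over both.\<close>

definition avg_moment :: "letter list list \<Rightarrow> complex" where
  "avg_moment ws = (\<Sum>p | p permutes {..<N}. mixed_moment p ws) / fact N"

lemma avg_moment_loop:
  "avg_moment ((a @ LH # b) # ws) =
    (\<Sum>(u, v)\<leftarrow>splits (b @ a). avg_moment (u # v # ws)) +
    (\<Sum>(w, r)\<leftarrow>picks ws. \<Sum>(u, v)\<leftarrow>splits w. avg_moment (((b @ a) @ v @ u) # r)) / (of_nat N)\<^sup>2"
proof -
  let ?P = "{p. p permutes {..<N}}" and ?c = "1 / fact N :: complex"
  have avg: "avg_moment vs = (\<Sum>p\<in>?P. ?c * mixed_moment p vs)" for vs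
    by (simp add: avg_moment_def sum_divide_distrib)
  let ?S = "\<lambda>p. \<Sum>(u, v)\<leftarrow>splits (b @ a). mixed_moment p (u # v # ws)"
  let ?R = "\<lambda>p. \<Sum>(w, r)\<leftarrow>picks ws. \<Sum>(u, v)\<leftarrow>splits w. mixed_moment p (((b @ a) @ v @ u) # r)"
  have "avg_moment ((a @ LH # b) # ws) = (\<Sum>p\<in>?P. ?c * (?S p + ?R p / (of_nat N)\<^sup>2))"
    unfolding avg by (rule sum.cong[OF refl]) (simp only: mixed_moment_loop mem_Collect_eq)
  also have "\<dots> = (\<Sum>p\<in>?P. ?c * ?S p) + (\<Sum>p\<in>?P. ?c * ?R p) / (of_nat N)\<^sup>2"
    by (simp only: distrib_left sum.distrib sum_divide_distrib times_divide_eq_right)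
  also have "(\<Sum>p\<in>?P. ?c * ?S p) = (\<Sum>(u, v)\<leftarrow>splits (b @ a). avg_moment (u # v # ws))"
    unfolding avg case_prod_beta' sum_list_const_mult[symmetric] sum_sum_list_swap ..
  also have "(\<Sum>p\<in>?P. ?c * ?R p) =
      (\<Sum>(w, r)\<leftarrow>picks ws. \<Sum>(u, v)\<leftarrow>splits w. avg_moment (((b @ a) @ v @ u) # r))"
    unfolding avg case_prod_beta' sum_list_const_mult[symmetric] sum_sum_list_swap ..
  finally show ?thesis .
qed

lemma avg_moment_no_H:
  assumes "\<forall>w\<in>set ws. LH \<notin> set w"
  shows "avg_moment ws =
    (\<Sum>p | p permutes {..<N}. \<Prod>w\<leftarrow>ws. complex_of_real (fixed_ratio N p (charge w))) / fact N"
proof -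
  have "mixed_moment p ws = (\<Prod>w\<leftarrow>ws. complex_of_real (fixed_ratio N p (charge w)))"
    if "p permutes {..<N}" for p
  proof -
    have "map (word_trace N p h) ws = map (\<lambda>w. complex_of_real (fixed_ratio N p (charge w))) ws" for h
      using assms word_trace_no_H[OF permutes_bij[OF that]] by simp
    then have "(\<Prod>w\<leftarrow>ws. word_trace N p h w) = (\<Prod>w\<leftarrow>ws. complex_of_real (fixed_ratio N p (charge w)))" for h
      by (rule arg_cong)
    then show ?thesis by (simp add: mixed_moment_def prob_space)
  qed
  then show ?thesis by (simp add: avg_moment_def)
qed

lemma avg_moment_perm: "avg_moment (us @ w # vs) = avg_moment (w # us @ vs)"
  by (simp add: avg_moment_def mixed_moment_def mult_ac)

lemma avg_moment_conj: "avg_moment [LUi # w @ [LU]] = avg_moment [w]"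
proof -
  have "mixed_moment p [LUi # w @ [LU]] = mixed_moment p [w]" if "p permutes {..<N}" for p
    unfolding mixed_moment_def by (simp only: list.map prod_list.Cons word_trace_conj_cancel[OF that])
  then show ?thesis by (simp add: avg_moment_def)
qed

end

subsection \<open>Matrices\<close>

lemma mat_adjoint_entry:
  fixes A :: "complex mat"
  assumes "A \<in> carrier_mat N N" "i < N" "j < N"
  shows "mat_adjoint A $$ (i, j) = cnj (A $$ (j, i))"
  using assms by (simp add: mat_adjoint_def mat_of_rows_def conjugate_complex_def)

lemma mat_adjoint_carrier: "A \<in> carrier_mat N N \<Longrightarrow> mat_adjoint A \<in> carrier_mat N N"
  for A :: "complex mat"
  by (rule carrier_matI) (simp_all add: mat_adjoint_def)

text \<open>Agreement is demanded only below \<open>N\<close>, where matrix entries are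
  specified.\<close>

lemma entry_cong:
  assumes p: "p permutes {..<N}" and h: "\<And>i j. i < N \<Longrightarrow> j < N \<Longrightarrow> h i j = h' i j"
    and "i < N"
  shows "entry N p h w i j = entry N p h' w i j"
  using \<open>i < N\<close>
proof (induction w arbitrary: i)
  case (Cons l w)
  then show ?case
    using permutes_less[OF p Cons.prems] by (cases l) (auto simp: h intro!: sum.cong)
qed simp

lemma word_trace_cong:
  assumes "p permutes {..<N}" "\<And>i j. i < N \<Longrightarrow> j < N \<Longrightarrow> h i j = h' i j"
  shows "word_trace N p h w = word_trace N p h' w"
  using entry_cong[OF assms] by (simp add: word_trace_def)

definition perm_mat :: "nat \<Rightarrow> (nat \<Rightarrow> nat) \<Rightarrow> complex mat" where
  "perm_mat N p = mat N N (\<lambda>(i, j). if i = p j then 1 else 0)"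

lemma permutation_mats_eq: "permutation_mats N = perm_mat N ` {p. p permutes {..<N}}"
  by (auto simp: permutation_mats_def perm_mat_def)

lemma perm_mat_carrier [simp]: "perm_mat N p \<in> carrier_mat N N"
  by (simp add: perm_mat_def)

text \<open>The matrix determines \<open>p\<close> below \<open>N\<close>, and elsewhere
  \<open>p\<close> is the identity. Hence there are \<open>fact N\<close> permutation matrices, and
  the value of \<open>U\<close> determines the permutation.\<close>

lemma inj_on_perm_mat: "inj_on (perm_mat N) {p. p permutes {..<N}}"
proof (rule inj_onI)
  fix p q assume pq: "p \<in> {p. p permutes {..<N}}" "q \<in> {p. p permutes {..<N}}"
    and eq: "perm_mat N p = perm_mat N q"
  show "p = q"
  proof
    fix j
    show "p j = q j"
    proof (cases "j < N")
      case True
      then have "p j < N" using pq permutes_less by blast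
      then have "perm_mat N p $$ (p j, j) = 1" using True by (simp add: perm_mat_def)
      then have "perm_mat N q $$ (p j, j) = 1" using eq by simp
      then show ?thesis using True \<open>p j < N\<close> by (simp add: perm_mat_def split: if_splits)
    next
      case False
      then show ?thesis using pq by (simp add: permutes_def)
    qed
  qed
qed

lemma perm_mat_mult_entry:
  assumes p: "p permutes {..<N}" and H: "H \<in> carrier_mat N N" and ij: "i < N" "j < N"
  shows "(perm_mat N p * H) $$ (i, j) = H $$ (inv_into UNIV p i, j)"
proof -
  have "(perm_mat N p * H) $$ (i, j) = (\<Sum>k<N. perm_mat N p $$ (i, k) * H $$ (k, j))"
    using H ij by (simp add: perm_mat_def scalar_prod_def lessThan_atLeast0)
  also have "\<dots> = (\<Sum>k<N. if k = inv_into UNIV p i then H $$ (k, j) else 0)"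
    using ij permutes_inverses[OF p] by (intro sum.cong refl) (auto simp: perm_mat_def)
  also have "\<dots> = H $$ (inv_into UNIV p i, j)"
    using permutes_less(2)[OF p ij(1)] by simp
  finally show ?thesis .
qed

text \<open>Links genuine matrix products to symbolic words. The assumption \<open>herm\<close>
  turns the conjugated entries in the adjoint of the product into entries of \<open>h\<close> again,
  as the word \<open>[LH, LUi]\<close> requires.\<close>

lemma mat_prod_list_entry:
  assumes p: "p permutes {..<N}" and H: "H \<in> carrier_mat N N"
    and h: "\<And>i j. i < N \<Longrightarrow> j < N \<Longrightarrow> H $$ (i, j) = h i j"
    and herm: "\<And>i j. i < N \<Longrightarrow> j < N \<Longrightarrow> cnj (h i j) = h j i"
  shows "mat_prod_list N (map (star_pow mat_adjoint (perm_mat N p * H)) es) \<in> carrier_mat N N \<and>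
    (\<forall>i<N. \<forall>j<N. mat_prod_list N (map (star_pow mat_adjoint (perm_mat N p * H)) es) $$ (i, j) =
      entry N p h (circ_word es) i j)"
proof (induction es)
  case Nil
  show ?case by (simp add: mat_prod_list_def)
next
  case (Cons e es)
  let ?X = "perm_mat N p * H" and ?R = "mat_prod_list N (map (star_pow mat_adjoint (perm_mat N p * H)) es)"
  have X: "?X \<in> carrier_mat N N" by (rule mult_carrier_mat[OF perm_mat_carrier H])
  have Xe: "star_pow mat_adjoint ?X e \<in> carrier_mat N N"
    using X mat_adjoint_carrier by (cases e) auto
  have entX: "star_pow mat_adjoint ?X e $$ (i, j) = entry N p h (exponent_letters e) i j"
    if ij: "i < N" "j < N" for i j
  proof (cases e)
    case Plain
    have "entry N p h [LU, LH] i j = (\<Sum>k<N. if k = j then h (inv_into UNIV p i) k else 0)"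
      by (simp add: if_distrib cong: if_cong)
    then show ?thesis
      using Plain ij h permutes_less(2)[OF p ij(1)] by (simp add: perm_mat_mult_entry[OF p H])
  next
    case Star
    have "entry N p h [LH, LUi] i j = (\<Sum>k<N. if k = inv_into UNIV p j then h i k else 0)"
    proof -
      have "p k = j \<longleftrightarrow> k = inv_into UNIV p j" for k
        using permutes_inverses[OF p] by metis
      then show ?thesis unfolding entry.simps by (intro sum.cong refl) simp
    qed
    then show ?thesis
      using Star ij h herm permutes_less(2)[OF p ij(2)]
      by (simp add: mat_adjoint_entry[OF X] perm_mat_mult_entry[OF p H])
  qed
  have prod: "mat_prod_list N (map (star_pow mat_adjoint ?X) (e # es)) = star_pow mat_adjoint ?X e * ?R"
    by (simp add: mat_prod_list_def)
  have "(star_pow mat_adjoint ?X e * ?R) $$ (i, j) = entry N p h (circ_word (e # es)) i j"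
    if ij: "i < N" "j < N" for i j
  proof -
    have "(star_pow mat_adjoint ?X e * ?R) $$ (i, j) =
        (\<Sum>k<N. star_pow mat_adjoint ?X e $$ (i, k) * ?R $$ (k, j))"
      using Xe Cons.IH ij by (auto simp: scalar_prod_def lessThan_atLeast0)
    also have "\<dots> = (\<Sum>k<N. entry N p h (exponent_letters e) i k * entry N p h (circ_word es) k j)"
      using Cons.IH ij entX by (intro sum.cong refl) auto
    also have "\<dots> = entry N p h (circ_word (e # es)) i j"
      using entry_append[OF p ij(1)] by simp
    finally show ?thesis .
  qed
  then show ?case unfolding prod using Xe Cons.IH by auto
qed

lemma normalized_trace_circ_word:
  assumes "p permutes {..<N}" "H \<in> carrier_mat N N"
    and "\<And>i j. i < N \<Longrightarrow> j < N \<Longrightarrow> H $$ (i, j) = h i j"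
    and "\<And>i j. i < N \<Longrightarrow> j < N \<Longrightarrow> cnj (h i j) = h j i"
  shows "normalized_trace (mat_prod_list N (map (star_pow mat_adjoint (perm_mat N p * H)) es)) =
    word_trace N p h (circ_word es)"
  using mat_prod_list_entry[OF assms, of es] by (auto simp: normalized_trace_def word_trace_def)

subsection \<open>Averaging over the random permutation\<close>

text \<open>The GUE entries as a function of the Gaussian matrix alone, the form in which
  independence of the two random matrices can be used. Only the root of 2 appears, since
  \<open>gaussian_mat\<close> is already scaled by \<open>N\<close>.\<close>

definition sym_entries :: "complex mat \<Rightarrow> nat \<Rightarrow> nat \<Rightarrow> complex" where
  "sym_entries A i j = (cnj (A $$ (j, i)) + A $$ (i, j)) / complex_of_real (sqrt 2)"

lemma measurable_mat_entry:
  assumes "i < N" "j < N"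
  shows "(\<lambda>A. A $$ (i, j)) \<in> borel_measurable (borel_mat N)"
proof -
  have "(\<lambda>A. \<lambda>ij\<in>{..<N} \<times> {..<N}. A $$ ij) \<in> borel_mat N \<rightarrow>\<^sub>M (\<Pi>\<^sub>M ij\<in>{..<N} \<times> {..<N}. borel :: complex measure)"
    unfolding borel_mat_def by (rule measurable_vimage_algebra1) (auto simp: space_PiM)
  then have "(\<lambda>A. (\<lambda>ij\<in>{..<N} \<times> {..<N}. A $$ ij) (i, j)) \<in> borel_measurable (borel_mat N)"
    by (rule measurable_compose[OF _ measurable_component_singleton]) (use assms in auto)
  then show ?thesis using assms by simp
qed

lemma measurable_word_trace:
  assumes p: "p permutes {..<N}"
  shows "(\<lambda>A. word_trace N p (sym_entries A) w) \<in> borel_measurable (borel_mat N)"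
proof -
  have sym: "(\<lambda>A. sym_entries A i j) \<in> borel_measurable (borel_mat N)" if "i < N" "j < N" for i j
  proof -
    have "cnj \<in> borel_measurable borel"
      by (intro borel_measurable_continuous_onI continuous_on_cnj continuous_on_id)
    from measurable_compose[OF measurable_mat_entry[OF that(2,1)] this]
    have "(\<lambda>A. cnj (A $$ (j, i))) \<in> borel_measurable (borel_mat N)" .
    then show ?thesis
      unfolding sym_entries_def using measurable_mat_entry[OF that]
      by (intro borel_measurable_divide borel_measurable_add borel_measurable_const)
  qed
  have "(\<lambda>A. entry N p (sym_entries A) w i j) \<in> borel_measurable (borel_mat N)" if "i < N" for i j
    using that
  proof (induction w arbitrary: i)
    case (Cons l w)
    then show ?case
      using permutes_less[OF p Cons.prems] sym
      by (cases l) (auto intro!: borel_measurable_sum borel_measurable_times)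
  qed simp
  then show ?thesis unfolding word_trace_def
    by (intro borel_measurable_divide borel_measurable_sum borel_measurable_const) auto
qed

text \<open>A singleton is cut out by finitely many entry equations. This is required because
  independence refers to \<open>borel_mat\<close>, whereas the law of \<open>U\<close> is given on a
  finite discrete space.\<close>

lemma measurable_mat_indicator:
  assumes "P \<in> carrier_mat N N"
  shows "(\<lambda>A. indicator {P} A :: complex) \<in> borel_measurable (borel_mat N)"
proof -
  have sp: "space (borel_mat N) = carrier_mat N N" by (simp add: borel_mat_def)
  have "{P} = {A \<in> space (borel_mat N). \<forall>ij\<in>{..<N} \<times> {..<N}. A $$ ij = P $$ ij}"
    using assms unfolding sp by (auto intro!: eq_matI)
  also have "\<dots> \<in> sets (borel_mat N)"
  proof (intro sets.sets_Collect_finite_All)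
    fix ij assume "ij \<in> {..<N} \<times> {..<N}"
    then have "(\<lambda>A. A $$ ij) \<in> borel_measurable (borel_mat N)"
      using measurable_mat_entry by auto
    then have "(\<lambda>A. A $$ ij) -` {P $$ ij} \<inter> space (borel_mat N) \<in> sets (borel_mat N)"
      by (rule measurable_sets) simp
    moreover have "(\<lambda>A. A $$ ij) -` {P $$ ij} \<inter> space (borel_mat N) =
        {A \<in> space (borel_mat N). A $$ ij = P $$ ij}" by blast
    ultimately show "{A \<in> space (borel_mat N). A $$ ij = P $$ ij} \<in> sets (borel_mat N)" by simp
  qed simp
  finally show ?thesis by (rule borel_measurable_indicator)
qed

text \<open>The trace is decomposed according to the value of \<open>U\<close>. In each summand the
  indicator is independent of a function of the Gaussian matrix, so the expectation splits into
  \<open>1 / fact N\<close> and a moment for a fixed permutation.\<close>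

lemma (in gue_model) expectation_normalized_trace:
  assumes U: "U \<in> measurable M (count_space (permutation_mats N))"
    and uniform: "distr M (count_space (permutation_mats N)) U = uniform_count_measure (permutation_mats N)"
    and indep: "indep_var (borel_mat N) U (borel_mat N) (gaussian_mat N f)"
  shows "expectation (\<lambda>\<omega>. normalized_trace
      (mat_prod_list N (map (star_pow mat_adjoint (U \<omega> * gue_mat N f \<omega>)) es))) =
    avg_moment [circ_word es]"
proof -
  let ?S = "{p. p permutes {..<N}}" and ?w = "circ_word es"
  define F where "F p \<omega> = word_trace N p (sym_entries (gaussian_mat N f \<omega>)) ?w" for p \<omega>
  have finS: "finite ?S" by (rule finite_permutations) simp
  have G: "gaussian_mat N f \<omega> \<in> carrier_mat N N" for \<omega> by (simp add: gaussian_mat_def)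
  have sym_gue: "sym_entries (gaussian_mat N f \<omega>) i j = gue \<omega> i j" if "i < N" "j < N" for i j \<omega>
    using that by (simp add: sym_entries_def gaussian_mat_def gue_def real_sqrt_mult add_divide_distrib
        mult.commute[of "complex_of_real (sqrt 2)"])
  have F_trs: "F p \<omega> = trs p \<omega> [?w]" if "p \<in> ?S" for p \<omega>
    using word_trace_cong[of p N "sym_entries (gaussian_mat N f \<omega>)" "gue \<omega>" ?w] sym_gue that
    by (simp add: F_def)
  have tr: "normalized_trace (mat_prod_list N (map (star_pow mat_adjoint (perm_mat N p * gue_mat N f \<omega>)) es))
      = F p \<omega>" if "p \<in> ?S" for p \<omega>
    unfolding F_def
  proof (rule normalized_trace_circ_word)
    show "gue_mat N f \<omega> \<in> carrier_mat N N"
      using G mat_adjoint_carrier[OF G] by (simp add: gue_mat_def)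
    show "gue_mat N f \<omega> $$ (i, j) = sym_entries (gaussian_mat N f \<omega>) i j" if "i < N" "j < N" for i j
      using that G[of \<omega>] mat_adjoint_carrier[OF G, of \<omega>]
      by (simp add: gue_mat_def sym_entries_def mat_adjoint_entry[OF G])
    show "cnj (sym_entries (gaussian_mat N f \<omega>) i j) = sym_entries (gaussian_mat N f \<omega>) j i" for i j
      by (simp add: sym_entries_def add.commute)
  qed (use that in simp)
  have intF: "integrable M (F p)" and expF: "expectation (F p) = mixed_moment p [?w]" if "p \<in> ?S" for p
  proof -
    have "F p = (\<lambda>\<omega>. trs p \<omega> [?w])" using F_trs[OF that] by blast
    then show "integrable M (F p)" "expectation (F p) = mixed_moment p [?w]"
      using integrable_word_traces[of p "[?w]"] that by (simp_all only: mixed_moment_def mem_Collect_eq)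
  qed
  have cardS: "card (permutation_mats N) = fact N"
    unfolding permutation_mats_eq card_image[OF inj_on_perm_mat]
    by (rule card_permutations) simp_all
  have finP: "finite (permutation_mats N)" unfolding permutation_mats_eq using finS by simp
  have ind: "integrable M (\<lambda>\<omega>. indicator {perm_mat N p} (U \<omega>) :: complex)"
    "expectation (\<lambda>\<omega>. indicator {perm_mat N p} (U \<omega>) :: complex) = 1 / fact N" if p: "p \<in> ?S" for p
  proof -
    have mem: "perm_mat N p \<in> permutation_mats N" using p by (auto simp: permutation_mats_eq)
    have meas: "(indicator {perm_mat N p} :: complex mat \<Rightarrow> complex) \<in> borel_measurable (count_space (permutation_mats N))"
      by simp
    show "integrable M (\<lambda>\<omega>. indicator {perm_mat N p} (U \<omega>) :: complex)"
      by (rule integrable_const_bound[of _ 1])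
        (use measurable_compose[OF U meas] in \<open>auto split: split_indicator\<close>)
    have meas': "(indicator {perm_mat N p} :: complex mat \<Rightarrow> real) \<in> borel_measurable (count_space (permutation_mats N))"
      by simp
    have "expectation (\<lambda>\<omega>. indicator {perm_mat N p} (U \<omega>) :: complex) =
        expectation (\<lambda>\<omega>. complex_of_real (indicator {perm_mat N p} (U \<omega>)))"
      by (rule Bochner_Integration.integral_cong[OF refl]) (simp split: split_indicator)
    also have "\<dots> = complex_of_real (expectation (\<lambda>\<omega>. indicator {perm_mat N p} (U \<omega>)))"
      by (rule integral_complex_of_real)
    also have "expectation (\<lambda>\<omega>. indicator {perm_mat N p} (U \<omega>) :: real) =
        integral\<^sup>L (uniform_count_measure (permutation_mats N)) (indicator {perm_mat N p})"
      unfolding uniform[symmetric] by (rule integral_distr[OF U meas', symmetric])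
    also have "\<dots> = (\<Sum>P\<in>permutation_mats N. indicator {perm_mat N p} P) / real (card (permutation_mats N))"
      by (rule integral_uniform_count_measure[OF finP])
    also have "(\<Sum>P\<in>permutation_mats N. indicator {perm_mat N p} P :: real) = 1"
      using mem finP by (simp add: indicator_def)
    finally show "expectation (\<lambda>\<omega>. indicator {perm_mat N p} (U \<omega>) :: complex) = 1 / fact N"
      using cardS by simp
  qed
  have indep_p: "indep_var borel (\<lambda>\<omega>. indicator {perm_mat N p} (U \<omega>) :: complex) borel (F p)"
    if "p \<in> ?S" for p
    using indep_var_compose[OF indep measurable_mat_indicator[OF perm_mat_carrier] measurable_word_trace[of p N ?w]] that
    by (simp add: comp_def F_def[abs_def])
  have "expectation (\<lambda>\<omega>. normalized_trace
      (mat_prod_list N (map (star_pow mat_adjoint (U \<omega> * gue_mat N f \<omega>)) es))) =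
    expectation (\<lambda>\<omega>. \<Sum>p\<in>?S. indicator {perm_mat N p} (U \<omega>) * F p \<omega>)"
  proof (rule Bochner_Integration.integral_cong[OF refl])
    fix \<omega> assume "\<omega> \<in> space M"
    then have "U \<omega> \<in> permutation_mats N" using measurable_space[OF U] by simp
    then obtain q where q: "q \<in> ?S" "U \<omega> = perm_mat N q" by (auto simp: permutation_mats_eq)
    have "(\<Sum>p\<in>?S. indicator {perm_mat N p} (U \<omega>) * F p \<omega>) = (\<Sum>p\<in>?S. if p = q then F p \<omega> else 0)"
    proof (rule sum.cong[OF refl])
      fix p assume "p \<in> ?S"
      then have "perm_mat N p = perm_mat N q \<longleftrightarrow> p = q"
        by (rule inj_on_eq_iff[OF inj_on_perm_mat _ q(1)])
      then have "indicator {perm_mat N p} (U \<omega>) = (if p = q then 1 else 0 :: complex)"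
        unfolding q(2) indicator_def by auto
      then show "indicator {perm_mat N p} (U \<omega>) * F p \<omega> = (if p = q then F p \<omega> else 0)" by simp
    qed
    also have "\<dots> = F q \<omega>" using finS q(1) by simp
    finally show "normalized_trace (mat_prod_list N (map (star_pow mat_adjoint (U \<omega> * gue_mat N f \<omega>)) es)) =
      (\<Sum>p\<in>?S. indicator {perm_mat N p} (U \<omega>) * F p \<omega>)"
      using tr[OF q(1)] q(2) by simp
  qed
  also have "\<dots> = (\<Sum>p\<in>?S. expectation (\<lambda>\<omega>. indicator {perm_mat N p} (U \<omega>) * F p \<omega>))"
    by (rule Bochner_Integration.integral_sum) (rule indep_var_integrable[OF indep_p ind(1) intF])
  also have "\<dots> = (\<Sum>p\<in>?S. 1 / fact N * mixed_moment p [?w])"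
    by (rule sum.cong[OF refl])
      (simp only: indep_var_lebesgue_integral[OF indep_p ind(1) intF] ind(2) expF)
  finally show ?thesis by (simp add: avg_moment_def sum_divide_distrib)
qed

theorem mainTheorem3:
  fixes M :: "nat \<Rightarrow> 'w measure"
    and f :: "nat \<Rightarrow> nat \<Rightarrow> nat \<Rightarrow> 'w \<Rightarrow> complex"
    and U :: "nat \<Rightarrow> 'w \<Rightarrow> complex mat"
    and cscale :: "complex \<Rightarrow> 'b::ring_1 \<Rightarrow> 'b"
    and star :: "'b \<Rightarrow> 'b"
    and \<phi> :: "'b \<Rightarrow> complex"
    and X :: 'b
  assumes prob: "\<And>N. N \<ge> 1 \<Longrightarrow> prob_space (M N)"
    and gaussian: "\<And>N i j. N \<ge> 1 \<Longrightarrow> i < N \<Longrightarrow> j < N \<Longrightarrow> std_complex_gaussian (M N) (f N i j)"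
    and indep_entries: "\<And>N. N \<ge> 1 \<Longrightarrow>
      prob_space.indep_vars (M N) (\<lambda>_. borel) (\<lambda>(i, j). f N i j) ({..<N} \<times> {..<N})"
    and perm: "\<And>N. N \<ge> 1 \<Longrightarrow> U N \<in> measurable (M N) (count_space (permutation_mats N))"
    and uniform: "\<And>N. N \<ge> 1 \<Longrightarrow>
      distr (M N) (count_space (permutation_mats N)) (U N) =
        uniform_count_measure (permutation_mats N)"
    and indep: "\<And>N. N \<ge> 1 \<Longrightarrow>
      prob_space.indep_var (M N) (borel_mat N) (U N) (borel_mat N) (gaussian_mat N (f N))"
    and space: "tracial_star_prob_space cscale star \<phi>"
    and circular: "standard_circular star \<phi> X"
  shows "\<forall>es :: star_exponent list. es \<noteq> [] \<longrightarrow>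
    (\<lambda>N. integral\<^sup>L (M N) (\<lambda>\<omega>. normalized_trace
        (mat_prod_list N (map (star_pow mat_adjoint (U N \<omega> * gue_mat N (f N) \<omega>)) es))))
      \<longlonglongrightarrow> \<phi> (prod_list (map (star_pow star X) es))"
proof (intro allI impI)
  fix es :: "star_exponent list" assume "es \<noteq> []"
  have model: "gue_model (M N) N (f N)" if "N \<ge> 1" for N
    unfolding gue_model_def gaussian_entries_def gaussian_entries_axioms_def gue_model_axioms_def
    using prob[OF that] indep_entries[OF that] gaussian[OF that] that by auto
  \<comment> \<open>The model requires \<open>N > 0\<close>; the value 0 at \<open>N = 0\<close> is
    a filler that does not affect the limit.\<close>
  define A where "A N ws = (if N \<ge> 1 then gue_model.avg_moment (M N) N (f N) ws else 0)" for N ws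
  have limit: "(\<lambda>N. A N ws) \<longlonglongrightarrow> (\<Prod>w\<leftarrow>ws. word_limit w)" for ws
  proof (rule loop_equation_limit)
    fix N :: nat and a b ws assume N: "N \<ge> 1"
    show "A N ((a @ LH # b) # ws) =
      (\<Sum>(u, v)\<leftarrow>splits (b @ a). A N (u # v # ws)) +
      (\<Sum>(w, r)\<leftarrow>picks ws. \<Sum>(u, v)\<leftarrow>splits w. A N (((b @ a) @ v @ u) # r)) / (of_nat N)\<^sup>2"
      unfolding A_def if_P[OF N] by (rule gue_model.avg_moment_loop[OF model[OF N]])
  next
    fix N us w vs
    show "A N (us @ w # vs) = A N (w # us @ vs)"
      unfolding A_def using gue_model.avg_moment_perm[OF model] by simp
  next
    fix ws :: "letter list list" assume ws: "\<forall>w\<in>set ws. LH \<notin> set w"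
    show "(\<lambda>N. A N ws) \<longlonglongrightarrow> (\<Prod>w\<leftarrow>ws. if charge w = 0 then 1 else 0)"
    proof (rule Lim_transform_eventually[OF average_no_H_tendsto], rule eventually_sequentiallyI[of 1])
      fix N :: nat assume N: "N \<ge> 1"
      show "(\<Sum>p | p permutes {..<N}. \<Prod>w\<leftarrow>ws. complex_of_real (fixed_ratio N p (charge w))) / fact N = A N ws"
        unfolding A_def if_P[OF N] by (rule gue_model.avg_moment_no_H[OF model[OF N] ws, symmetric])
    qed
  qed
  have limit1: "(\<lambda>N. A N [w]) \<longlonglongrightarrow> word_limit w" for w
    using limit[of "[w]"] by simp
  have conj: "word_limit (LUi # w @ [LU]) = word_limit w" for w
  proof - \<comment> \<open>true of the limits because the trace is cyclic at every finite \<open>N\<close>\<close>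
    have "A N [LUi # w @ [LU]] = A N [w]" for N
      unfolding A_def using gue_model.avg_moment_conj[OF model] by simp
    then show ?thesis
      using LIMSEQ_unique[OF limit1[of "LUi # w @ [LU]"]] limit1[of w] by simp
  qed
  \<comment> \<open>Here \<open>C\<close> is \<open>word_limit\<close> composed with
    \<open>circ_word\<close>.\<close>
  have "\<phi> (prod_list (map (star_pow star X) es)) = word_limit (circ_word es)"
    by (rule circular_moment_eq[OF circular \<open>es \<noteq> []\<close>])
      (simp add: word_limit_no_H, rule word_limit_circ_word_Cons[OF conj])
  moreover have "(\<lambda>N. integral\<^sup>L (M N) (\<lambda>\<omega>. normalized_trace
        (mat_prod_list N (map (star_pow mat_adjoint (U N \<omega> * gue_mat N (f N) \<omega>)) es))))
      \<longlonglongrightarrow> word_limit (circ_word es)"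
  proof (rule Lim_transform_eventually[OF limit1], rule eventually_sequentiallyI[of 1])
    fix N :: nat assume N: "N \<ge> 1"
    show "A N [circ_word es] = integral\<^sup>L (M N) (\<lambda>\<omega>. normalized_trace
        (mat_prod_list N (map (star_pow mat_adjoint (U N \<omega> * gue_mat N (f N) \<omega>)) es)))"
      unfolding A_def if_P[OF N]
      by (rule gue_model.expectation_normalized_trace[OF model[OF N] perm[OF N] uniform[OF N] indep[OF N], symmetric])
  qed
  ultimately show "(\<lambda>N. integral\<^sup>L (M N) (\<lambda>\<omega>. normalized_trace
        (mat_prod_list N (map (star_pow mat_adjoint (U N \<omega> * gue_mat N (f N) \<omega>)) es))))
      \<longlonglongrightarrow> \<phi> (prod_list (map (star_pow star X) es))" by (simp only:)
qed

end
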